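(* Let $d\geq1$ and $n\geq2$ be integers, let $p\in(0,1)$ with $p>1/n^d$, and let $F\subseteq[0,1]^d$ be the fractal percolation with parameters $n$ and $p$. Then, conditioned on $F$ being non-empty, almost surely $$\dim_{\mathrm A}F=d$$ and, for all $k\leq d$ and all $\pi\in\Pi_{d,k}$ simultaneously, $$\dim_{\mathrm A}\pi F=k.$$
   Context: Assouad dimension: for a non-empty bounded set $F\subseteq\mathbb{R}^d$ let $N_r(F)$ be the smallest number of sets of diameter at most $r$ needed to cover $F$. Then $\dim_{\mathrm A}F$ is the infimum of all $\alpha \geq 0$ for which there exist $C,\rho>0$ such that for all $0<r<R\leq\rho$, $\sup_{x\in F}N_r(B(x,R)\cap F)\leq C(R/r)^\alpha$. Fractal (Mandelbrot) percolation: start with the unit cube $[0,1]^d$. Divide it into the mesh of $n^d$ compact subcubes of side length $1/n$, and keep each subcube independently with probability $p$ (discarding it otherwise); let $Q_1$ be the union of the kept cubes. Repeat the process independently inside each surviving cube (dividing it into $n^d$ compact subcubes of side $1/n^2$, each kept independently with probability $p$) to get $Q_2\subseteq Q_1$, and so on, giving a decreasing sequence of compact sets $Q_k$, a union of cubes of side $n^{-k}$. Then $F=\bigcap_{k\in\mathbb{N}}Q_k$. $\Pi_{d,k}$ is the set of all orthogonal projections from $\mathbb{R}^d$ onto $k$-dimensional linear subspaces of $\mathbb{R}^d$ (identified with $\mathbb{R}^k$). "Simultaneously" means that there is a single event of full conditional probability on which the conclusion holds for all $k$ and all $\pi$. *)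

theory Defs
  imports "HOL-Probability.Probability"
begin

section \<open>Assouad dimension\<close>

text \<open>
  Smallest number of sets of diameter at most \<open>r\<close> needed to cover \<open>F\<close>; the conjunct
  \<^term>\<open>bounded U\<close> is needed because \<^const>\<open>diameter\<close> is unspecified on unbounded sets.
  For bounded \<open>F\<close> in a Euclidean space and \<open>r > 0\<close> a finite cover exists, so \<open>LEAST\<close> is
  well-defined.
\<close>

definition covering_number :: "real \<Rightarrow> 'a::euclidean_space set \<Rightarrow> nat" where
  "covering_number r F = (LEAST N. \<exists>\<U>. finite \<U> \<and> card \<U> = N \<and> F \<subseteq> \<Union>\<U> \<and>
      (\<forall>U\<in>\<U>. bounded U \<and> diameter U \<le> r))"

text \<open>
  Intended for non-empty bounded \<open>F\<close>: then the set below is non-empty (it contains the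
  dimension of the ambient space) and bounded below by \<open>0\<close>, so the real-valued
  infimum is the true one.
\<close>

definition assouad_dim :: "'a::euclidean_space set \<Rightarrow> real" where
  "assouad_dim F = Inf {\<alpha>. \<alpha> \<ge> 0 \<and> (\<exists>C>0. \<exists>\<rho>>0. \<forall>r R. 0 < r \<and> r < R \<and> R \<le> \<rho> \<longrightarrow>
      (\<forall>x\<in>F. real (covering_number r (cball x R \<inter> F)) \<le> C * (R / r) powr \<alpha>))}"

section \<open>Orthogonal projections onto subspaces of dimension \<open>k\<close>\<close>

text \<open>
  The image is kept inside the ambient space; identifying the subspace isometrically with
  \<open>k\<close>-dimensional Euclidean space does not affect \<^const>\<open>assouad_dim\<close>, since the covering numbers
  are unchanged when covering sets are intersected with the subspace.
\<close>

definition orth_projections :: "nat \<Rightarrow> ('a::euclidean_space \<Rightarrow> 'a) set" where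
  "orth_projections k = {\<pi>. \<exists>V. subspace V \<and> dim V = k \<and>
      (\<forall>x. \<pi> x \<in> V \<and> (\<forall>v\<in>V. orthogonal (x - \<pi> x) v))}"

section \<open>Fractal percolation\<close>

text \<open>
  The pair \<open>(m, i)\<close> names the closed mesh cube of side \<open>n\<^sup>-\<^sup>m\<close> whose least corner
  is \<open>i / n\<^sup>m\<close>. Its parent is the pair \<open>(m - 1, i div n)\<close>, with \<open>div\<close> taken coordinatewise.
\<close>

definition mesh_cube :: "nat \<Rightarrow> nat \<Rightarrow> nat ^ 'd \<Rightarrow> (real ^ 'd) set" where
  "mesh_cube n m i = cbox (\<chi> j. real (i $ j) / real n ^ m) (\<chi> j. (real (i $ j) + 1) / real n ^ m)"

definition mesh_indices :: "nat \<Rightarrow> (nat \<times> (nat ^ 'd)) set" where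
  "mesh_indices n = {(m, i). m \<ge> 1 \<and> (\<forall>j. i $ j < n ^ m)}"

text \<open>
  A keep/discard decision is attached to every mesh cube; the decision for a cube whose parent
  has already been discarded is never used.
\<close>

locale fractal_percolation = prob_space M
  for M :: "'w measure" and n :: nat and p :: real
    and keep :: "nat \<times> (nat ^ 'd) \<Rightarrow> 'w \<Rightarrow> bool" +
  assumes indep_keep: "indep_vars (\<lambda>_. count_space UNIV) keep (mesh_indices n)"
    and prob_keep: "\<And>c. c \<in> mesh_indices n \<Longrightarrow> prob {\<omega> \<in> space M. keep c \<omega>} = p"

primrec surviving ::
    "nat \<Rightarrow> (nat \<times> (nat ^ 'd) \<Rightarrow> 'w \<Rightarrow> bool) \<Rightarrow> 'w \<Rightarrow> nat \<Rightarrow> (nat ^ 'd) set" where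
  "surviving n keep \<omega> 0 = {\<chi> j. 0}"
| "surviving n keep \<omega> (Suc m) =
     {i. (\<chi> j. i $ j div n) \<in> surviving n keep \<omega> m \<and> keep (Suc m, i) \<omega>}"

definition percolation_level ::
    "nat \<Rightarrow> (nat \<times> (nat ^ 'd) \<Rightarrow> 'w \<Rightarrow> bool) \<Rightarrow> 'w \<Rightarrow> nat \<Rightarrow> (real ^ 'd) set" where
  "percolation_level n keep \<omega> m = (\<Union>i\<in>surviving n keep \<omega> m. mesh_cube n m i)"

definition percolation_set ::
    "nat \<Rightarrow> (nat \<times> (nat ^ 'd) \<Rightarrow> 'w \<Rightarrow> bool) \<Rightarrow> 'w \<Rightarrow> (real ^ 'd) set" where
  "percolation_set n keep \<omega> = (\<Inter>m. percolation_level n keep \<omega> m)"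

end

theory Submission
  imports Defs
begin

text \<open>
  The upper bound is deterministic: a subset of a \<open>k\<close>-dimensional subspace has Assouad dimension at
  most \<open>k\<close> (\<open>assouad_exponent_dim\<close>). For the lower bound it suffices that \<open>F\<close> is as dense as desired in
  some balls of arbitrarily small radius, because this property passes to every projection with
  the same balls (\<open>assouad_dim_projection\<close>). So a single almost sure event has to be found, on which
  there are, for each \<open>N\<close>, surviving cubes at arbitrarily deep levels such that all their descendants \<open>N\<close>
  levels further down are kept and contain points of \<open>F\<close>. Call such a cube full to depth \<open>N\<close>.

  Let \<open>D = n\<^sup>d\<close> be the number of children of a cube and \<open>g u = 1 - (1 - p u)\<^sup>D\<close>. If a property of cubes
  depends only on the decisions inside the cube and has probability \<open>u\<close> for every cube, then by independence of the
  subtrees of the children the probability that a cube has a kept child with this property is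
  \<open>g u\<close>. Since \<open>p D > 1\<close>, the concave function \<open>g\<close> has a unique positive fixed point \<open>h\<close>, which attracts
  \<open>1\<close> and all points of \<open>(0, h]\<close> (\<open>survival_fun_iterates_converge\<close>). Iterating from \<open>1\<close> shows that \<open>h\<close> is the
  probability that \<open>F\<close> is non-empty. Being full to depth \<open>N\<close> has a positive probability \<open>q \<le> h\<close>, and
  \<open>g\<^sup>L q\<close> is the probability that some surviving cube at level \<open>L\<close> is full to depth \<open>N\<close>. As
  \<open>g\<^sup>L q\<close> also tends to \<open>h\<close>, and full cubes force \<open>F\<close> to be non-empty, such cubes exist at arbitrarily
  large levels almost surely when \<open>F\<close> is non-empty (\<open>AE_survives_imp_reaches_full\<close>).
\<close>

section \<open>Assouad dimension of projections of locally dense sets\<close>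

definition finite_cover :: "real \<Rightarrow> 'a::euclidean_space set \<Rightarrow> 'a set set \<Rightarrow> bool" where
  "finite_cover r F \<U> \<longleftrightarrow> finite \<U> \<and> F \<subseteq> \<Union>\<U> \<and> (\<forall>U\<in>\<U>. bounded U \<and> diameter U \<le> r)"

lemma covering_number_le:
  assumes "finite_cover r F \<U>"
  shows "covering_number r F \<le> card \<U>"
  unfolding covering_number_def
  by (rule Least_le) (use assms in \<open>auto simp: finite_cover_def\<close>)

lemma covering_number_attained:
  assumes "finite_cover r F \<U>"
  obtains \<V> where "finite_cover r F \<V>" "card \<V> = covering_number r F"
proof -
  have "\<exists>N \<V>. finite \<V> \<and> card \<V> = N \<and> F \<subseteq> \<Union>\<V> \<and> (\<forall>U\<in>\<V>. bounded U \<and> diameter U \<le> r)"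
    using assms by (auto simp: finite_cover_def)
  from LeastI_ex[OF this] show ?thesis
    using that by (auto simp: finite_cover_def covering_number_def)
qed

text \<open>
  A set of diameter at most \<open>r\<close> contains at most one point of an \<open>r\<close>-separated family. The given cover
  only serves to ensure that the minimum in the covering number is attained.
\<close>

lemma covering_number_ge_separated:
  fixes F :: "'a::euclidean_space set"
  assumes cover: "finite_cover r F \<U>" and sub: "f ` I \<subseteq> F"
    and sep: "\<And>a b. \<lbrakk>a \<in> I; b \<in> I; a \<noteq> b\<rbrakk> \<Longrightarrow> dist (f a) (f b) > r"
  shows "card I \<le> covering_number r F"
proof -
  obtain \<V> where \<V>: "finite_cover r F \<V>" "card \<V> = covering_number r F"
    using covering_number_attained[OF cover] .
  have "\<forall>a\<in>I. \<exists>U\<in>\<V>. f a \<in> U"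
    using \<V>(1) sub unfolding finite_cover_def by blast
  then obtain U where U: "\<And>a. a \<in> I \<Longrightarrow> U a \<in> \<V> \<and> f a \<in> U a"
    by metis
  have "inj_on U I"
  proof (rule inj_onI, rule ccontr)
    fix a b assume ab: "a \<in> I" "b \<in> I" "U a = U b" "a \<noteq> b"
    have "bounded (U a)" "diameter (U a) \<le> r"
      using U[OF ab(1)] \<V>(1) by (auto simp: finite_cover_def)
    then have "dist (f a) (f b) \<le> r"
      using diameter_bounded_bound[of "U a" "f a" "f b"] U[OF ab(1)] U[OF ab(2)] ab(3) by auto
    then show False using sep[OF ab(1,2,4)] by simp
  qed
  then have "card I \<le> card \<V>"
    using U \<V>(1) by (intro card_inj_on_le[of U]) (auto simp: finite_cover_def)
  then show ?thesis using \<V>(2) by simp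
qed

lemma orthonormal_sum_inner:
  fixes B :: "'a::real_inner set"
  assumes B: "finite B" "pairwise orthogonal B" "\<And>b. b \<in> B \<Longrightarrow> norm b = 1" and b: "b \<in> B"
  shows "(\<Sum>b\<in>B. c b *\<^sub>R b) \<bullet> b = c b"
proof -
  have "(\<Sum>b\<in>B. c b *\<^sub>R b) \<bullet> b = (\<Sum>b'\<in>B. c b' * (b' \<bullet> b))"
    by (simp add: inner_sum_left)
  also have "\<dots> = (\<Sum>b'\<in>B. if b' = b then c b else 0)"
    using B(2) B(3)[OF b] b
    by (intro sum.cong) (auto simp: pairwise_def orthogonal_def norm_eq_1)
  finally show ?thesis using B(1) b by simp
qed

lemma orthonormal_norm_le:
  fixes v :: "'a::real_inner"
  assumes B: "finite B" "pairwise orthogonal B" "\<And>b. b \<in> B \<Longrightarrow> norm b = 1" and v: "v \<in> span B"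
  shows "norm v \<le> (\<Sum>b\<in>B. \<bar>v \<bullet> b\<bar>)"
proof -
  obtain c where c: "v = (\<Sum>b\<in>B. c b *\<^sub>R b)"
    using v B(1) by (auto simp: span_finite)
  have "norm v \<le> (\<Sum>b\<in>B. norm (c b *\<^sub>R b))"
    unfolding c by (rule norm_sum)
  also have "\<dots> = (\<Sum>b\<in>B. \<bar>v \<bullet> b\<bar>)"
    by (intro sum.cong) (simp_all add: c orthonormal_sum_inner[OF B] B(3))
  finally show ?thesis .
qed

text \<open>
  Cut the ball along the grid of mesh \<open>t = r / (k + 1)\<close> with respect to an orthonormal basis of \<open>V\<close>. Two
  points of a cell differ by at most \<open>t\<close> in each of the \<open>k\<close> coordinates, so their distance is at most
  \<open>k t \<le> r\<close>, and about \<open>(2 R / t)\<^sup>k\<close> cells suffice. The constant \<open>2 k + 6\<close> absorbs the rounding, by \<open>R / r > 1\<close>.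
\<close>

lemma subspace_ball_cover:
  fixes V :: "'a::euclidean_space set"
  assumes "subspace V" "dim V = k" "x \<in> V" "0 < r" "r < R"
  obtains \<U> where "finite_cover r (cball x R \<inter> V) \<U>"
    "real (card \<U>) \<le> (2 * real k + 6) ^ k * (R / r) powr real k"
proof -
  obtain B where B: "B \<subseteq> V" "pairwise orthogonal B" "\<And>b. b \<in> B \<Longrightarrow> norm b = 1"
      "independent B" "card B = k" "span B = V"
    using orthonormal_basis_subspace[OF assms(1)] assms(2) by metis
  have finB: "finite B"
    using B(4) by (rule independent_imp_finite)
  define t where "t = r / (real k + 1)"
  define K where "K = \<lceil>R / t\<rceil>"
  define cell where "cell g = {v \<in> cball x R \<inter> V. \<forall>b\<in>B. \<lfloor>((v - x) \<bullet> b) / t\<rfloor> = g b}" for g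
  define \<U> where "\<U> = cell ` (B \<rightarrow>\<^sub>E {- K - 1..K})"
  have t: "t > 0" using assms by (simp add: t_def)
  have "R / t > 0" using t assms by simp
  then have "K \<ge> 0" unfolding K_def by linarith
  have small: "diameter (cell g) \<le> r" for g
  proof (rule diameter_le)
    fix u v assume uv: "u \<in> cell g" "v \<in> cell g"
    have close: "\<bar>(u - v) \<bullet> b\<bar> \<le> t" if "b \<in> B" for b
    proof -
      have "\<lfloor>((u - x) \<bullet> b) / t\<rfloor> = \<lfloor>((v - x) \<bullet> b) / t\<rfloor>"
        using uv that by (simp add: cell_def)
      then have "\<bar>((u - x) \<bullet> b) / t - ((v - x) \<bullet> b) / t\<bar> \<le> 1"
        by linarith
      also have "((u - x) \<bullet> b) / t - ((v - x) \<bullet> b) / t = ((u - v) \<bullet> b) / t"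
        by (simp add: inner_diff_left diff_divide_distrib)
      finally show ?thesis using t by (simp add: abs_divide)
    qed
    have "u - v \<in> span B"
      using uv assms(1) B(6) by (auto simp: cell_def subspace_diff)
    then have "norm (u - v) \<le> (\<Sum>b\<in>B. \<bar>(u - v) \<bullet> b\<bar>)"
      by (intro orthonormal_norm_le finB B)
    also have "\<dots> \<le> (\<Sum>b\<in>B. t)"
      by (intro sum_mono close)
    also have "\<dots> = real k * t" using B(5) by simp
    also have "\<dots> \<le> r" using assms(4) by (simp add: t_def field_simps)
    finally show "norm (u - v) \<le> r" .
  qed (use assms in simp)
  have covers: "cball x R \<inter> V \<subseteq> \<Union>\<U>"
  proof
    fix v assume v: "v \<in> cball x R \<inter> V"
    define g where "g = (\<lambda>b\<in>B. \<lfloor>((v - x) \<bullet> b) / t\<rfloor>)"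
    have "\<lfloor>((v - x) \<bullet> b) / t\<rfloor> \<in> {- K - 1..K}" if "b \<in> B" for b
    proof -
      have "\<bar>(v - x) \<bullet> b\<bar> \<le> norm (v - x) * norm b"
        by (rule Cauchy_Schwarz_ineq2)
      also have "\<dots> \<le> R" using v B(3)[OF that] by (simp add: dist_norm norm_minus_commute)
      finally have "\<bar>((v - x) \<bullet> b) / t\<bar> \<le> R / t"
        using t by (simp add: abs_divide divide_right_mono)
      then have "\<bar>((v - x) \<bullet> b) / t\<bar> \<le> of_int K"
        unfolding K_def by linarith
      then have "- of_int K - 1 \<le> ((v - x) \<bullet> b) / t" "((v - x) \<bullet> b) / t < of_int K + 1"
        by linarith+
      then show ?thesis by (auto simp: le_floor_iff floor_le_iff)
    qed
    then have "g \<in> B \<rightarrow>\<^sub>E {- K - 1..K}"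
      by (auto simp: g_def)
    moreover have "v \<in> cell g" using v by (auto simp: cell_def g_def)
    ultimately show "v \<in> \<Union>\<U>" by (auto simp: \<U>_def)
  qed
  have finPi: "finite (B \<rightarrow>\<^sub>E {- K - 1..K})"
    using finB by (intro finite_PiE) auto
  have "finite_cover r (cball x R \<inter> V) \<U>"
    unfolding finite_cover_def
  proof (intro conjI ballI)
    show "finite \<U>" using finPi by (simp add: \<U>_def)
    fix U assume "U \<in> \<U>"
    then obtain g where g: "U = cell g" by (auto simp: \<U>_def)
    show "bounded U" unfolding g cell_def
      by (rule bounded_subset[OF bounded_cball[of x R]]) auto
    show "diameter U \<le> r" using small g by simp
  qed (fact covers)
  moreover have "real (card \<U>) \<le> (2 * real k + 6) ^ k * (R / r) powr real k"
  proof -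
    have "card \<U> \<le> card (B \<rightarrow>\<^sub>E {- K - 1..K})"
      unfolding \<U>_def using finPi by (rule card_image_le)
    also have "\<dots> = nat (2 * K + 2) ^ k"
      using finB B(5) by (simp add: card_PiE add.commute)
    finally have "real (card \<U>) \<le> real (nat (2 * K + 2) ^ k)"
      by (rule of_nat_mono)
    also have "\<dots> = (2 * of_int K + 2) ^ k"
      using \<open>K \<ge> 0\<close> by simp
    also have "\<dots> \<le> ((2 * real k + 6) * (R / r)) ^ k"
    proof (rule power_mono)
      have Rr: "R / r \<ge> 1" using assms by simp
      have "of_int K \<le> R / t + 1" unfolding K_def by linarith
      moreover have "R / t = (real k + 1) * (R / r)"
        by (simp add: t_def)
      ultimately have "2 * of_int K + 2 \<le> 2 * ((real k + 1) * (R / r)) + 4 * 1"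
        by simp
      also have "\<dots> \<le> 2 * ((real k + 1) * (R / r)) + 4 * (R / r)"
        using Rr by linarith
      finally show "2 * of_int K + 2 \<le> (2 * real k + 6) * (R / r)"
        by (simp add: algebra_simps)
      show "0 \<le> 2 * real_of_int K + 2" using \<open>K \<ge> 0\<close> by simp
    qed
    also have "\<dots> = (2 * real k + 6) ^ k * (R / r) powr real k"
      using assms by (simp add: power_mult_distrib powr_realpow del: times_divide_eq_right)
    finally show ?thesis .
  qed
  ultimately show ?thesis by (rule that)
qed

lemma finite_cover_subset: "finite_cover r F \<U> \<Longrightarrow> G \<subseteq> F \<Longrightarrow> finite_cover r G \<U>"
  by (auto simp: finite_cover_def)

definition assouad_exponent :: "'a::euclidean_space set \<Rightarrow> real \<Rightarrow> bool" where
  "assouad_exponent F \<alpha> \<longleftrightarrow> \<alpha> \<ge> 0 \<and> (\<exists>C>0. \<exists>\<rho>>0. \<forall>r R. 0 < r \<and> r < R \<and> R \<le> \<rho> \<longrightarrow>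
      (\<forall>x\<in>F. real (covering_number r (cball x R \<inter> F)) \<le> C * (R / r) powr \<alpha>))"

lemma assouad_exponent_dim:
  assumes "subspace V" "dim V = k" "F \<subseteq> V"
  shows "assouad_exponent F (real k)"
  unfolding assouad_exponent_def
proof (intro conjI)
  have bound: "real (covering_number r (cball x R \<inter> F)) \<le> (2 * real k + 6) ^ k * (R / r) powr real k"
    if rR: "0 < r" "r < R" and "x \<in> F" for r R x
  proof -
    have "x \<in> V" using assms(3) \<open>x \<in> F\<close> by blast
    obtain \<U> where \<U>: "finite_cover r (cball x R \<inter> V) \<U>"
        "real (card \<U>) \<le> (2 * real k + 6) ^ k * (R / r) powr real k"
      using subspace_ball_cover[OF assms(1,2) \<open>x \<in> V\<close> rR] .
    have "finite_cover r (cball x R \<inter> F) \<U>"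
      using \<U>(1) assms(3) by (auto intro: finite_cover_subset)
    then have "real (covering_number r (cball x R \<inter> F)) \<le> real (card \<U>)"
      using covering_number_le by simp
    with \<U>(2) show ?thesis by linarith
  qed
  have pos: "(2 * real k + 6) ^ k > 0" by simp
  show "\<exists>C>0. \<exists>\<rho>>0. \<forall>r R. 0 < r \<and> r < R \<and> R \<le> \<rho> \<longrightarrow>
      (\<forall>x\<in>F. real (covering_number r (cball x R \<inter> F)) \<le> C * (R / r) powr real k)"
    using bound by (intro exI[of _ "(2 * real k + 6) ^ k"] conjI pos exI[of _ "1::real"]) auto
qed simp

text \<open>
  The weak form of having the unit ball as a weak tangent: blowing up suitable arbitrarily small
  balls makes the set as dense in the unit ball as desired.
\<close>

definition locally_almost_dense :: "'a::metric_space set \<Rightarrow> bool" where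
  "locally_almost_dense F \<longleftrightarrow>
     (\<forall>\<eta>>0. \<forall>\<delta>>0. \<exists>z s. 0 < s \<and> s < \<delta> \<and> (\<forall>y\<in>cball z s. \<exists>f\<in>F. dist f y \<le> \<eta> * s))"

lemma orth_projection_nonexpansive:
  fixes \<pi> :: "'a::euclidean_space \<Rightarrow> 'a"
  assumes V: "subspace V" and \<pi>: "\<And>x. \<pi> x \<in> V" "\<And>x v. v \<in> V \<Longrightarrow> orthogonal (x - \<pi> x) v"
  shows "dist (\<pi> x) (\<pi> y) \<le> dist x y"
proof -
  let ?w = "\<pi> x - \<pi> y"
  have "?w \<in> V" using V \<pi>(1) by (simp add: subspace_diff)
  then have "(x - \<pi> x) \<bullet> ?w = 0" "(y - \<pi> y) \<bullet> ?w = 0"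
    using \<pi>(2) by (auto simp: orthogonal_def)
  then have "(x - y) \<bullet> ?w = ?w \<bullet> ?w"
    by (simp add: inner_diff_left)
  then have "norm ?w * norm ?w \<le> norm (x - y) * norm ?w"
    using norm_cauchy_schwarz[of "x - y" ?w]
    by (simp add: power2_norm_eq_inner[symmetric] power2_eq_square)
  then show ?thesis
    by (cases "norm ?w = 0") (auto simp: dist_norm mult_le_cancel_right)
qed

lemma orth_projection_translate:
  fixes \<pi> :: "'a::euclidean_space \<Rightarrow> 'a"
  assumes V: "subspace V" and \<pi>: "\<And>x. \<pi> x \<in> V" "\<And>x v. v \<in> V \<Longrightarrow> orthogonal (x - \<pi> x) v"
    and v: "v \<in> V"
  shows "\<pi> (x + v) = \<pi> x + v"
proof -
  let ?w = "\<pi> (x + v) - (\<pi> x + v)"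
  have "?w \<in> V" using V v \<pi>(1) by (simp add: subspace_diff subspace_add)
  then have "(x + v - \<pi> (x + v)) \<bullet> ?w = 0" "(x - \<pi> x) \<bullet> ?w = 0"
    using \<pi>(2) by (auto simp: orthogonal_def)
  then have "?w \<bullet> ?w = 0"
    by (simp add: inner_diff_left inner_add_left)
  then show ?thesis by simp
qed

text \<open>
  A ball of radius \<open>s\<close> in which \<open>F\<close> is very dense contains a \<open>k\<close>-dimensional grid parallel to \<open>V\<close> with
  \<open>A\<close> points along each axis and spacing \<open>t\<close> comparable to \<open>s / A\<close>. The projection moves this
  grid rigidly, and it does not increase the distance from the grid points to nearby points of \<open>F\<close>. Hence
  \<open>\<pi> ` F\<close> contains \<open>A\<^sup>k\<close> points that are \<open>t / 4\<close>-separated and lie in a ball of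
  radius \<open>4 s\<close>. An admissible exponent \<open>\<alpha>\<close> bounds their number by a constant times \<open>A\<^sup>\<alpha>\<close>, for every \<open>A\<close>.
  The choice of \<open>z\<close>, \<open>s\<close> does not depend on \<open>\<pi>\<close>, which is why all projections can be treated on the
  same event later on.
\<close>

lemma assouad_exponent_ge:
  fixes F :: "'a::euclidean_space set"
  assumes dense: "locally_almost_dense F"
    and V: "subspace V" "dim V = k"
    and \<pi>: "\<And>x. \<pi> x \<in> V" "\<And>x v. v \<in> V \<Longrightarrow> orthogonal (x - \<pi> x) v"
    and exponent: "assouad_exponent (\<pi> ` F) \<alpha>"
  shows "real k \<le> \<alpha>"
proof (rule ccontr)
  assume "\<not> real k \<le> \<alpha>"
  then have lt: "\<alpha> < real k" by simp
  obtain C \<rho> where C: "C > 0" and \<rho>: "\<rho> > 0" and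
    bound: "\<And>r R x. \<lbrakk>0 < r; r < R; R \<le> \<rho>; x \<in> \<pi> ` F\<rbrakk> \<Longrightarrow>
      real (covering_number r (cball x R \<inter> \<pi> ` F)) \<le> C * (R / r) powr \<alpha>"
    using exponent unfolding assouad_exponent_def by metis
  obtain B where B: "B \<subseteq> V" "pairwise orthogonal B" "\<And>b. b \<in> B \<Longrightarrow> norm b = 1"
      "independent B" "card B = k" "span B = V"
    using orthonormal_basis_subspace[OF V(1)] V(2) by metis
  have finB: "finite B"
    using B(4) by (rule independent_imp_finite)
  have main: "real A ^ k \<le> C * (16 * (real k + 1) * real A) powr \<alpha>" if A: "A \<ge> 1" for A :: nat
  proof -
    \<comment> \<open>Chosen so that \<open>\<eta> * s\<close> is a quarter of the spacing \<open>t\<close> below.\<close>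
    define \<eta> where "\<eta> = 1 / (4 * (real k + 1) * real A)"
    have \<eta>: "\<eta> > 0" using A by (simp add: \<eta>_def)
    obtain z s where s: "0 < s" "s < \<rho> / 4" and
      zs: "\<And>y. y \<in> cball z s \<Longrightarrow> \<exists>f\<in>F. dist f y \<le> \<eta> * s"
      using dense \<eta> \<rho> unfolding locally_almost_dense_def by (metis zero_less_divide_iff zero_less_numeral)
    define t where "t = s / ((real k + 1) * real A)"
    have t: "t > 0" using s A by (simp add: t_def)
    have \<eta>s: "\<eta> * s = t / 4" by (simp add: t_def \<eta>_def)
    let ?I = "B \<rightarrow>\<^sub>E {..<A}"
    define w where "w a = (\<Sum>b\<in>B. (t * real (a b)) *\<^sub>R b)" for a :: "'a \<Rightarrow> nat"
    have wV: "w a \<in> V" for a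
      unfolding w_def using B(1) V(1) by (auto intro!: subspace_sum subspace_scale)
    have w_inner: "w a \<bullet> b = t * real (a b)" if "b \<in> B" for a b
      unfolding w_def using orthonormal_sum_inner[OF finB B(2,3) that] by simp
    have w_norm: "norm (w a) \<le> s" if a: "a \<in> ?I" for a
    proof -
      have "norm (w a) \<le> (\<Sum>b\<in>B. norm ((t * real (a b)) *\<^sub>R b))"
        unfolding w_def by (rule norm_sum)
      also have "\<dots> \<le> (\<Sum>b\<in>B. t * real A)"
      proof (rule sum_mono)
        fix b assume "b \<in> B"
        then have "a b < A" using a by auto
        then show "norm ((t * real (a b)) *\<^sub>R b) \<le> t * real A"
          using B(3)[OF \<open>b \<in> B\<close>] t by simp
      qed
      also have "\<dots> = real k * (t * real A)" using B(5) by simp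
      also have "\<dots> = s * (real k / (real k + 1))" using A by (simp add: t_def)
      also have "\<dots> \<le> s * 1" using s by (intro mult_left_mono) auto
      finally show ?thesis by simp
    qed
    have "\<exists>f\<in>F. dist f (z + w a) \<le> \<eta> * s" if "a \<in> ?I" for a
      using zs[of "z + w a"] w_norm[OF that] by (simp add: dist_norm)
    then obtain f where f: "\<And>a. a \<in> ?I \<Longrightarrow> f a \<in> F \<and> dist (f a) (z + w a) \<le> t / 4"
      unfolding \<eta>s by metis
    have near: "dist (\<pi> (f a)) (\<pi> z + w a) \<le> t / 4" if "a \<in> ?I" for a
      using orth_projection_nonexpansive[OF V(1) \<pi>, of "f a" "z + w a"]
        orth_projection_translate[OF V(1) \<pi> wV, of z a] f[OF that] by simp
    have sep: "dist (\<pi> (f a)) (\<pi> (f a')) > t / 4" if aa: "a \<in> ?I" "a' \<in> ?I" "a \<noteq> a'" for a a'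
    proof -
      obtain b where b: "b \<in> B" "a b \<noteq> a' b"
        using PiE_ext[OF aa(1,2)] aa(3) by blast
      have "t \<le> t * \<bar>real (a b) - real (a' b)\<bar>" using t b(2) by simp
      also have "\<dots> = \<bar>(w a - w a') \<bullet> b\<bar>"
        using t by (simp add: inner_diff_left w_inner[OF b(1)] abs_mult flip: right_diff_distrib)
      also have "\<dots> \<le> norm (w a - w a') * norm b" by (rule Cauchy_Schwarz_ineq2)
      finally have "t \<le> dist (\<pi> z + w a) (\<pi> z + w a')"
        using B(3)[OF b(1)] by (simp add: dist_norm)
      then show ?thesis
        using near[OF aa(1)] near[OF aa(2)] t
          dist_triangle[of "\<pi> z + w a" "\<pi> z + w a'" "\<pi> (f a)"]
          dist_triangle[of "\<pi> (f a)" "\<pi> z + w a'" "\<pi> (f a')"]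
        by (simp add: dist_commute)
    qed
    define a0 where "a0 = (\<lambda>b\<in>B. 0::nat)"
    have a0: "a0 \<in> ?I" using A by (auto simp: a0_def)
    define x where "x = \<pi> (f a0)"
    have t_le: "t \<le> s"
    proof -
      have "1 * 1 \<le> (real k + 1) * real A" using A by (intro mult_mono) auto
      then show ?thesis using s by (simp add: t_def divide_le_eq)
    qed
    have inball: "\<pi> (f a) \<in> cball x (4 * s) \<inter> \<pi> ` F" if a: "a \<in> ?I" for a
    proof -
      have "dist (\<pi> z + w a0) (\<pi> z + w a) \<le> norm (w a0) + norm (w a)"
        by (simp add: dist_norm norm_triangle_ineq4)
      then have "dist (\<pi> z + w a0) (\<pi> z + w a) \<le> 2 * s"
        using w_norm[OF a] w_norm[OF a0] by linarith
      then have "dist x (\<pi> (f a)) \<le> 4 * s"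
        using near[OF a] near[OF a0] t_le s(1)
          dist_triangle[of "\<pi> (f a0)" "\<pi> (f a)" "\<pi> z + w a0"]
          dist_triangle[of "\<pi> z + w a0" "\<pi> (f a)" "\<pi> z + w a"]
        unfolding x_def by (simp add: dist_commute)
      then show ?thesis using f[OF a] by simp
    qed
    have lt4: "t / 4 < 4 * s" using t_le s by simp
    have "x \<in> V" using \<pi>(1) by (simp add: x_def)
    obtain \<U> where "finite_cover (t / 4) (cball x (4 * s) \<inter> V) \<U>"
      using subspace_ball_cover[OF V \<open>x \<in> V\<close> _ lt4] t by auto
    then have "finite_cover (t / 4) (cball x (4 * s) \<inter> \<pi> ` F) \<U>"
      using \<pi>(1) by (auto intro: finite_cover_subset)
    then have "card ?I \<le> covering_number (t / 4) (cball x (4 * s) \<inter> \<pi> ` F)"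
      by (rule covering_number_ge_separated[where f = "\<lambda>a. \<pi> (f a)"]) (use inball sep in auto)
    moreover have "card ?I = A ^ k" using finB B(5) by (simp add: card_PiE)
    ultimately have "real A ^ k \<le> real (covering_number (t / 4) (cball x (4 * s) \<inter> \<pi> ` F))"
      by (metis of_nat_mono of_nat_power)
    also have "\<dots> \<le> C * (4 * s / (t / 4)) powr \<alpha>"
      using f[OF a0] t lt4 s by (intro bound) (auto simp: x_def)
    also have "4 * s / (t / 4) = 16 * (real k + 1) * real A"
      using s A by (simp add: t_def field_simps)
    finally show ?thesis .
  qed
  define c where "c = C * (16 * (real k + 1)) powr \<alpha>"
  have "real A powr (real k - \<alpha>) \<le> c" if "A \<ge> 1" for A :: nat
    using main[OF that] that
    by (simp add: c_def powr_mult powr_diff powr_realpow divide_le_eq mult_ac)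
  moreover have "filterlim (\<lambda>A::nat. real A powr (real k - \<alpha>)) at_top sequentially"
    using lt by (intro filterlim_compose[OF real_powr_at_top filterlim_real_sequentially]) auto
  then have "eventually (\<lambda>A::nat. real A powr (real k - \<alpha>) > c \<and> A \<ge> 1) sequentially"
    by (intro eventually_conj) (auto simp: filterlim_at_top_dense eventually_ge_at_top)
  then obtain A :: nat where "real A powr (real k - \<alpha>) > c" "A \<ge> 1"
    using eventually_happens by force
  ultimately show False by fastforce
qed

theorem assouad_dim_projection:
  fixes F :: "'a::euclidean_space set"
  assumes "locally_almost_dense F" "\<pi> \<in> orth_projections k"
  shows "assouad_dim (\<pi> ` F) = real k"
proof -
  obtain V where V: "subspace V" "dim V = k" "\<And>x. \<pi> x \<in> V"
      "\<And>x v. v \<in> V \<Longrightarrow> orthogonal (x - \<pi> x) v"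
    using assms(2) by (auto simp: orth_projections_def)
  have "assouad_exponent (\<pi> ` F) (real k)"
    using V by (intro assouad_exponent_dim[of V]) auto
  moreover have "real k \<le> \<alpha>" if "assouad_exponent (\<pi> ` F) \<alpha>" for \<alpha>
    using assouad_exponent_ge[OF assms(1) V that] .
  moreover have "assouad_dim (\<pi> ` F) = Inf {\<alpha>. assouad_exponent (\<pi> ` F) \<alpha>}"
    by (simp add: assouad_dim_def assouad_exponent_def)
  ultimately show ?thesis
    by (auto intro!: cInf_eq_minimum)
qed

section \<open>Iterating the survival function\<close>

text \<open>
  If each of \<open>D\<close> children is kept with probability \<open>p\<close> and, once kept, has some property with
  probability \<open>u\<close>, independently, then this is the probability that a kept child with the property
  exists. In terms of the offspring generating function \<open>f\<close> of the Galton-Watson process it is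
  \<open>1 - f (1 - u)\<close>.
\<close>

definition survival_fun :: "nat \<Rightarrow> real \<Rightarrow> real \<Rightarrow> real" where
  "survival_fun D p u = 1 - (1 - p * u) ^ D"

text \<open>
  The quotient of the survival function by \<open>u\<close>, in a form that makes sense at \<open>u = 0\<close> and is visibly
  decreasing.
\<close>

definition survival_slope :: "nat \<Rightarrow> real \<Rightarrow> real \<Rightarrow> real" where
  "survival_slope D p u = p * (\<Sum>j<D. (1 - p * u) ^ j)"

lemma survival_fun_slope: "survival_fun D p u = u * survival_slope D p u"
  using one_diff_power_eq[of "1 - p * u" D]
  by (simp add: survival_fun_def survival_slope_def mult_ac)

lemma survival_fun_bounds:
  assumes "0 < p" "p < 1" "0 \<le> u" "u \<le> v" "v \<le> 1"
  shows "0 \<le> survival_fun D p u" "survival_fun D p u \<le> survival_fun D p v"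
    "survival_fun D p v \<le> 1"
proof -
  have pv: "p * v \<le> 1" using assms mult_mono[of p 1 v 1] by simp
  have pu: "p * u \<le> p * v" using assms by simp
  then have "0 \<le> 1 - p * u" "1 - p * u \<le> 1" using pv mult_nonneg_nonneg[of p u] assms by linarith+
  then show "0 \<le> survival_fun D p u"
    by (simp add: survival_fun_def power_le_one)
  show "survival_fun D p u \<le> survival_fun D p v"
    using pu pv by (simp add: survival_fun_def power_mono)
  show "survival_fun D p v \<le> 1" using pv by (simp add: survival_fun_def)
qed

lemma survival_slope_strict_antimono:
  assumes "0 < p" "p < 1" "2 \<le> D" "0 \<le> u" "u < v" "v \<le> 1"
  shows "survival_slope D p v < survival_slope D p u"
proof -
  have pv: "p * v \<le> 1" using assms mult_mono[of p 1 v 1] by simp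
  have lt: "p * u < p * v" using assms by simp
  have "(\<Sum>j<D. (1 - p * v) ^ j) < (\<Sum>j<D. (1 - p * u) ^ j)"
  proof (rule sum_strict_mono_ex1)
    show "\<forall>j\<in>{..<D}. (1 - p * v) ^ j \<le> (1 - p * u) ^ j"
      using pv lt by (auto intro!: power_mono)
    show "\<exists>j\<in>{..<D}. (1 - p * v) ^ j < (1 - p * u) ^ j"
      using assms(3) lt by (intro bexI[of _ 1]) auto
  qed simp
  then show ?thesis using assms(1) by (simp add: survival_slope_def)
qed

text \<open>
  A positive fixed point of the survival function is a point of slope \<open>1\<close>. The slope is strictly
  decreasing, so there is at most one. It exists because the slope exceeds \<open>1\<close> near \<open>0\<close>: the
  iterates of \<open>1\<close> decrease, but not to \<open>0\<close>. Iterates of a smaller starting value \<open>u\<close> increase, because the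
  slope is at least \<open>1\<close> to the left of the fixed point, and their limit must be the same fixed
  point.
\<close>

lemma survival_fun_iterates_converge:
  assumes p: "0 < p" "p < 1" and super: "1 < p * real D"
  obtains h where "0 < h" "(\<lambda>L. (survival_fun D p ^^ L) 1) \<longlonglongrightarrow> h"
    "\<And>u. \<lbrakk>0 < u; u \<le> h\<rbrakk> \<Longrightarrow> (\<lambda>L. (survival_fun D p ^^ L) u) \<longlonglongrightarrow> h"
proof -
  let ?g = "survival_fun D p"
  have D: "2 \<le> D"
  proof (rule ccontr)
    assume "\<not> 2 \<le> D"
    then have "real D \<le> 1" by simp
    then have "p * real D \<le> p * 1" using p by (intro mult_left_mono) auto
    then show False using super p by linarith
  qed
  note g_bounds = survival_fun_bounds[OF p, where D = D]
  have cont: "isCont ?g u" for u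
    unfolding survival_fun_def by (intro continuous_intros)
  have fixpoint: "?g l = l" if "(\<lambda>L. (?g ^^ L) u) \<longlonglongrightarrow> l" for u l
  proof -
    have "(\<lambda>L. ?g ((?g ^^ L) u)) \<longlonglongrightarrow> ?g l"
      using isCont_tendsto_compose[OF cont that] .
    moreover have "(\<lambda>L. ?g ((?g ^^ L) u)) \<longlonglongrightarrow> l"
      using LIMSEQ_Suc[OF that] by simp
    ultimately show ?thesis by (rule LIMSEQ_unique)
  qed
  have range: "0 \<le> (?g ^^ L) u \<and> (?g ^^ L) u \<le> 1" if "0 \<le> u" "u \<le> 1" for L u
    by (induction L) (use that g_bounds[of 0 "(?g ^^ _) u"] g_bounds(1,3) in auto)
  have mono_iter: "(?g ^^ L) u \<le> (?g ^^ L) v" if "0 \<le> u" "u \<le> v" "v \<le> 1" for L u v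
    by (induction L) (use that range g_bounds(2) in auto)
  \<comment> \<open>At \<open>0\<close> the slope is \<open>p D > 1\<close>, so a small positive \<open>u0\<close> satisfies \<open>u0 \<le> ?g u0\<close>
    and bounds all iterates from below.\<close>
  have "isCont (survival_slope D p) 0"
    unfolding survival_slope_def by (intro continuous_intros)
  moreover have "survival_slope D p 0 > 1"
    using super by (simp add: survival_slope_def)
  ultimately have "eventually (\<lambda>u. survival_slope D p u > 1) (at 0)"
    unfolding isCont_def by (rule order_tendstoD(1))
  then obtain e where e: "e > 0" "\<And>u. \<lbrakk>u \<noteq> 0; dist u 0 < e\<rbrakk> \<Longrightarrow> survival_slope D p u > 1"
    unfolding eventually_at by auto
  define u0 where "u0 = min (e / 2) 1"
  have u0: "0 < u0" "u0 \<le> 1" "survival_slope D p u0 > 1"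
    using e by (auto simp: u0_def)
  have below: "u0 \<le> (?g ^^ L) u0" for L
  proof (induction L)
    case (Suc L)
    have "u0 \<le> ?g u0" using u0 by (simp add: survival_fun_slope)
    also have "\<dots> \<le> ?g ((?g ^^ L) u0)"
      using Suc u0 range by (intro g_bounds(2)) auto
    finally show ?case by simp
  qed simp
  have "decseq (\<lambda>L. (?g ^^ L) 1)"
  proof (rule decseq_SucI)
    fix L show "(?g ^^ Suc L) 1 \<le> (?g ^^ L) 1"
      using mono_iter[of "?g 1" 1 L] g_bounds(1)[of 1 1] g_bounds(3)[of 1 1]
      by (simp add: funpow_swap1)
  qed
  then obtain h where h: "(\<lambda>L. (?g ^^ L) 1) \<longlonglongrightarrow> h"
    by (rule decseq_convergent[of _ 0]) (use range[of 1] in auto)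
  have "u0 \<le> (?g ^^ L) 1" for L
    using below[of L] mono_iter[of u0 1 L] u0 by linarith
  then have "u0 \<le> h" using LIMSEQ_le_const[OF h] by blast
  then have h_pos: "0 < h" using u0 by simp
  have h_le: "h \<le> 1" using LIMSEQ_le_const2[OF h] range[of 1] by auto
  have h_fix: "?g h = h" using fixpoint[OF h] .
  then have h_slope: "survival_slope D p h = 1"
    using h_pos by (simp add: survival_fun_slope)
  have "(\<lambda>L. (?g ^^ L) u) \<longlonglongrightarrow> h" if u: "0 < u" "u \<le> h" for u
  proof -
    have "survival_slope D p u \<ge> 1"
      using survival_slope_strict_antimono[OF p D, of u h] u h_le h_slope by (cases "u = h") auto
    then have "u \<le> ?g u" using u by (simp add: survival_fun_slope)
    then have "incseq (\<lambda>L. (?g ^^ L) u)"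
      using mono_iter[of u "?g u"] g_bounds(3)[of u u] u h_le
      by (intro incseq_SucI) (simp add: funpow_swap1)
    moreover have "(?g ^^ L) h = h" for L
      by (induction L) (use h_fix in auto)
    then have le_h: "(?g ^^ L) u \<le> h" for L
      using mono_iter[of u h L] u h_le by simp
    ultimately obtain l where l: "(\<lambda>L. (?g ^^ L) u) \<longlonglongrightarrow> l" "\<And>L. (?g ^^ L) u \<le> l"
      using incseq_convergent[of "\<lambda>L. (?g ^^ L) u" h] by auto
    have "u \<le> l" using l(2)[of 0] by simp
    have "l \<le> h" using LIMSEQ_le_const2[OF l(1)] le_h by blast
    have "survival_slope D p l = 1"
      using fixpoint[OF l(1)] u \<open>u \<le> l\<close> by (simp add: survival_fun_slope)
    then have "l = h"
      using survival_slope_strict_antimono[OF p D, of l h] u \<open>u \<le> l\<close> \<open>l \<le> h\<close> h_le h_slope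
      by (cases "l = h") auto
    then show ?thesis using l(1) by simp
  qed
  then show ?thesis using that[OF h_pos h] by blast
qed

section \<open>The tree of mesh cubes\<close>

definition children :: "nat \<Rightarrow> nat \<times> (nat ^ 'd) \<Rightarrow> (nat \<times> (nat ^ 'd)) set" where
  "children n c = {c'. fst c' = Suc (fst c) \<and> (\<forall>j. snd c' $ j div n = snd c $ j)}"

text \<open>
  The cube \<open>c\<close> itself is included. The decision for \<open>c\<close> does not influence what happens inside
  \<open>c\<close>, so events below \<open>c\<close> are measured with respect to \<open>subtree n c - {c}\<close>.
\<close>

definition subtree :: "nat \<Rightarrow> nat \<times> (nat ^ 'd) \<Rightarrow> (nat \<times> (nat ^ 'd)) set" where
  "subtree n c = {c'. \<exists>k. fst c' = fst c + k \<and> (\<forall>j. snd c' $ j div n ^ k = snd c $ j)}"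

definition in_unit_cube :: "nat \<Rightarrow> nat \<times> (nat ^ 'd) \<Rightarrow> bool" where
  "in_unit_cube n c \<longleftrightarrow> (\<forall>j. snd c $ j < n ^ fst c)"

lemma children_finite_card:
  fixes c :: "nat \<times> (nat ^ 'd)"
  assumes "n > 0"
  shows "finite (children n c)" "card (children n c) = n ^ CARD('d)"
proof -
  let ?I = "\<lambda>j. {n * snd c $ j..<n * snd c $ j + n}"
  have div_iff: "a div n = b \<longleftrightarrow> n * b \<le> a \<and> a < n * b + n" for a b :: nat
    using assms by (metis div_nat_eqI dividend_less_times_div mult.commute mult_Suc_right
        times_div_less_eq_dividend add.commute)
  have bij: "bij_betw (\<lambda>f. (Suc (fst c), vec_lambda f)) (PiE UNIV ?I) (children n c)"
    by (rule bij_betw_byWitness[where f' = "\<lambda>c'. vec_nth (snd c')"])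
      (auto simp: children_def div_iff PiE_def Pi_def)
  have "finite (PiE UNIV ?I)" by (intro finite_PiE) auto
  then show "finite (children n c)" using bij_betw_finite[OF bij] by simp
  have "card (PiE UNIV ?I) = n ^ CARD('d)"
    by (subst card_PiE) auto
  then show "card (children n c) = n ^ CARD('d)"
    using bij_betw_same_card[OF bij] by simp
qed

lemma subtree_self: "c \<in> subtree n c"
  by (auto simp: subtree_def intro!: exI[of _ 0])

lemma subtree_child:
  assumes "c' \<in> children n c"
  shows "subtree n c' \<subseteq> subtree n c - {c}"
proof
  fix x assume "x \<in> subtree n c'"
  then obtain k where "fst x = fst c' + k" "\<forall>j. snd x $ j div n ^ k = snd c' $ j"
    by (auto simp: subtree_def)
  then have "fst x = fst c + Suc k" "\<forall>j. snd x $ j div n ^ Suc k = snd c $ j"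
    using assms by (auto simp: children_def div_mult2_eq power_Suc2 simp del: power_Suc)
  then show "x \<in> subtree n c - {c}"
    by (auto simp: subtree_def)
qed

lemma disjoint_subtrees: "disjoint_family_on (subtree n) (children n c)"
  by (auto simp: disjoint_family_on_def subtree_def children_def prod_eq_iff vec_eq_iff)

lemma in_unit_cube_subtree:
  assumes "in_unit_cube n c" "x \<in> subtree n c" "n > 0"
  shows "in_unit_cube n x"
proof -
  obtain k where k: "fst x = fst c + k" "\<And>j. snd x $ j div n ^ k = snd c $ j"
    using assms(2) by (auto simp: subtree_def)
  have "snd x $ j < n ^ fst c * n ^ k" for j
    using assms(1,3) k(2)[of j] by (simp add: in_unit_cube_def flip: div_less_iff_less_mult)
  then show ?thesis by (simp add: in_unit_cube_def k(1) power_add)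
qed

lemma in_unit_cube_child:
  assumes "in_unit_cube n c" "x \<in> children n c" "n > 0"
  shows "in_unit_cube n x"
  using assms in_unit_cube_subtree[of n c x] subtree_child[of x n c] subtree_self[of x n] by auto

lemma subtree_subset_mesh_indices:
  assumes "in_unit_cube n c" "n > 0"
  shows "subtree n c - {c} \<subseteq> mesh_indices n"
proof
  fix x assume x: "x \<in> subtree n c - {c}"
  then have "fst x \<noteq> 0"
    by (auto simp: subtree_def prod_eq_iff vec_eq_iff)
  with x show "x \<in> mesh_indices n"
    using in_unit_cube_subtree[OF assms(1) _ assms(2), of x]
    by (auto simp: mesh_indices_def in_unit_cube_def case_prod_beta)
qed

text \<open>
  Two ways to pass a property \<open>P\<close> of cubes from level \<open>L\<close> below \<open>c\<close> to \<open>c\<close>, given the configuration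
  \<open>\<kappa>\<close> of keep decisions: along some line of kept descendants, or along all lines of descent, all of them
  kept. The recursion runs from the root downwards, which makes the subtrees of the children, and
  hence independence, directly accessible.
\<close>

primrec reaches :: "nat \<Rightarrow> (nat \<times> (nat ^ 'd) \<Rightarrow> bool) \<Rightarrow> (nat \<times> (nat ^ 'd) \<Rightarrow> bool) \<Rightarrow>
    nat \<Rightarrow> nat \<times> (nat ^ 'd) \<Rightarrow> bool" where
  "reaches n \<kappa> P 0 c \<longleftrightarrow> P c"
| "reaches n \<kappa> P (Suc L) c \<longleftrightarrow> (\<exists>c'\<in>children n c. \<kappa> c' \<and> reaches n \<kappa> P L c')"

primrec full :: "nat \<Rightarrow> (nat \<times> (nat ^ 'd) \<Rightarrow> bool) \<Rightarrow> (nat \<times> (nat ^ 'd) \<Rightarrow> bool) \<Rightarrow>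
    nat \<Rightarrow> nat \<times> (nat ^ 'd) \<Rightarrow> bool" where
  "full n \<kappa> P 0 c \<longleftrightarrow> P c"
| "full n \<kappa> P (Suc L) c \<longleftrightarrow> (\<forall>c'\<in>children n c. \<kappa> c' \<and> full n \<kappa> P L c')"

definition survives :: "nat \<Rightarrow> (nat \<times> (nat ^ 'd) \<Rightarrow> bool) \<Rightarrow> nat \<times> (nat ^ 'd) \<Rightarrow> bool" where
  "survives n \<kappa> c \<longleftrightarrow> (\<forall>L. reaches n \<kappa> (\<lambda>_. True) L c)"

lemma reaches_mono: "reaches n \<kappa> P L c \<Longrightarrow> (\<And>c. P c \<Longrightarrow> Q c) \<Longrightarrow> reaches n \<kappa> Q L c"
  by (induction L arbitrary: c) auto

lemma reaches_add:
  "reaches n \<kappa> P (L + K) c \<longleftrightarrow> reaches n \<kappa> (reaches n \<kappa> P K) L c"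
  by (induction L arbitrary: c) auto

lemma reaches_antimono:
  assumes "L \<le> L'" "reaches n \<kappa> (\<lambda>_. True) L' c"
  shows "reaches n \<kappa> (\<lambda>_. True) L c"
proof -
  have "reaches n \<kappa> (reaches n \<kappa> (\<lambda>_. True) (L' - L)) L c"
    using assms by (simp flip: reaches_add)
  then show ?thesis by (rule reaches_mono) simp
qed

lemma children_nonempty: "n > 0 \<Longrightarrow> children n c \<noteq> {}"
  using children_finite_card(2)[of n c] by auto

lemma full_imp_survives:
  assumes "full n \<kappa> (survives n \<kappa>) N c" "n > 0"
  shows "survives n \<kappa> c"
  using assms(1)
proof (induction N arbitrary: c)
  case (Suc N)
  obtain c' where c': "c' \<in> children n c" using children_nonempty[OF assms(2), of c] by blast
  with Suc have "\<kappa> c'" "survives n \<kappa> c'" by auto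
  then have "reaches n \<kappa> (\<lambda>_. True) (Suc L) c" for L
    using c' by (auto simp: survives_def)
  then show ?case
    unfolding survives_def by (metis reaches.simps(1) not0_implies_Suc)
qed simp

lemma reaches_survives_imp_survives:
  assumes "reaches n \<kappa> (survives n \<kappa>) L c"
  shows "survives n \<kappa> c"
  unfolding survives_def
proof
  fix K
  have "reaches n \<kappa> (reaches n \<kappa> (\<lambda>_. True) K) L c"
    using assms by (rule reaches_mono) (simp add: survives_def)
  then have "reaches n \<kappa> (\<lambda>_. True) (L + K) c" by (simp add: reaches_add)
  then show "reaches n \<kappa> (\<lambda>_. True) K c" by (rule reaches_antimono[rotated]) simp
qed

section \<open>Surviving subtrees and the percolation set\<close>

context
  fixes n :: nat and keep :: "nat \<times> (nat ^ 'd::finite) \<Rightarrow> 'w \<Rightarrow> bool" and \<omega> :: 'w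
  assumes n: "n \<ge> 2"
begin

abbreviation (input) "kept \<equiv> (\<lambda>c. keep c \<omega>)"
abbreviation (input) "alive \<equiv> surviving n keep \<omega>"
abbreviation (input) "unit_cube_index \<equiv> (0::nat, (\<chi> j. 0) :: nat ^ 'd)"

lemma surviving_child:
  assumes "c' \<in> children n c" "keep c' \<omega>" "snd c \<in> alive (fst c)"
  shows "snd c' \<in> alive (fst c')"
proof -
  have parent: "\<forall>j. snd c' $ j div n = snd c $ j" and level: "fst c' = Suc (fst c)"
    using assms(1) unfolding children_def by blast+
  have "(\<chi> j. snd c' $ j div n) = snd c"
    unfolding vec_eq_iff vec_lambda_beta by (rule parent)
  moreover have "(Suc (fst c), snd c') = c'"
    unfolding level[symmetric] by (rule prod.collapse)
  ultimately show ?thesis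
    using assms(2,3) unfolding level by simp
qed

lemma reaches_surviving:
  assumes "reaches n kept P L c" "snd c \<in> alive (fst c)"
  obtains c' where "fst c' = fst c + L" "c' \<in> subtree n c" "snd c' \<in> alive (fst c')" "P c'"
  using assms
proof (induction L arbitrary: c thesis)
  case 0
  then show ?case using subtree_self[of c n] by auto
next
  case (Suc L)
  then obtain c1 where c1: "c1 \<in> children n c" "keep c1 \<omega>" "reaches n kept P L c1"
    by auto
  have "snd c1 \<in> alive (fst c1)"
    using surviving_child[OF c1(1,2)] Suc.prems by simp
  with Suc.IH[OF _ c1(3)] obtain c' where
    "fst c' = fst c1 + L" "c' \<in> subtree n c1" "snd c' \<in> alive (fst c')" "P c'"
    by metis
  moreover have "fst c1 = Suc (fst c)" using c1(1) by (simp add: children_def)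
  ultimately show ?case
    using Suc.prems(1)[of c'] subtree_child[OF c1(1)] by auto
qed

lemma surviving_reaches:
  assumes "i \<in> alive (m + L)"
  shows "\<exists>i'\<in>alive m. reaches n kept (\<lambda>_. True) L (m, i')"
  using assms
proof (induction L arbitrary: m)
  case (Suc L)
  then have "i \<in> alive (Suc m + L)" by simp
  from Suc.IH[OF this] obtain i' where
    i': "i' \<in> alive (Suc m)" "reaches n kept (\<lambda>_. True) L (Suc m, i')"
    by blast
  let ?i = "\<chi> j. i' $ j div n"
  have "?i \<in> alive m" "keep (Suc m, i') \<omega>" using i'(1) by auto
  moreover have "(Suc m, i') \<in> children n (m, ?i)" by (simp add: children_def)
  ultimately show ?case using i'(2) by auto
qed auto

lemma finite_surviving: "finite (alive m)"
proof (induction m)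
  case (Suc m)
  have "alive (Suc m) \<subseteq> (\<Union>i\<in>alive m. snd ` children n (m, i))"
    by (force simp: children_def image_iff)
  moreover have "finite (\<Union>i\<in>alive m. snd ` children n (m, i))"
    using Suc n by (intro finite_UN_I finite_imageI children_finite_card(1)) auto
  ultimately show ?case by (rule finite_subset)
qed simp

lemma mesh_cube_subtree:
  assumes "c' \<in> subtree n c"
  shows "mesh_cube n (fst c') (snd c') \<subseteq> mesh_cube n (fst c) (snd c)"
proof -
  obtain k where k: "fst c' = fst c + k" "\<And>j. snd c' $ j div n ^ k = snd c $ j"
    using assms by (auto simp: subtree_def)
  have "real (snd c $ j) / real n ^ fst c \<le> real (snd c' $ j) / real n ^ fst c' \<and>
     (real (snd c' $ j) + 1) / real n ^ fst c' \<le> (real (snd c $ j) + 1) / real n ^ fst c" for j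
  proof -
    have "snd c $ j * n ^ k \<le> snd c' $ j" "snd c' $ j + 1 \<le> (snd c $ j + 1) * n ^ k"
      using k(2)[of j, symmetric] n dividend_less_times_div[of "n ^ k" "snd c' $ j"]
      by (simp_all add: algebra_simps)
    then have "real (snd c $ j * n ^ k) \<le> real (snd c' $ j)"
        "real (snd c' $ j + 1) \<le> real ((snd c $ j + 1) * n ^ k)"
      by linarith+
    then have "real (snd c $ j) * real n ^ k / real n ^ fst c' \<le> real (snd c' $ j) / real n ^ fst c'"
      "(real (snd c' $ j) + 1) / real n ^ fst c' \<le> (real (snd c $ j) + 1) * real n ^ k / real n ^ fst c'"
      by (auto intro!: divide_right_mono simp: distrib_right)
    then show ?thesis
      using n by (simp add: k(1) power_add)
  qed
  then show ?thesis
    unfolding mesh_cube_def by (intro subset_box_imp) (auto simp: Basis_vec_def inner_axis)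
qed

lemma mesh_cube_nonempty: "mesh_cube n m i \<noteq> {}"
  unfolding mesh_cube_def using n
  by (auto simp: box_ne_empty Basis_vec_def inner_axis divide_right_mono)

lemma percolation_level_antimono:
  assumes "l \<le> m" shows "percolation_level n keep \<omega> m \<subseteq> percolation_level n keep \<omega> l"
  using assms
proof (rule lift_Suc_antimono_le[rotated])
  fix m
  show "percolation_level n keep \<omega> (Suc m) \<subseteq> percolation_level n keep \<omega> m"
  proof
    fix x assume "x \<in> percolation_level n keep \<omega> (Suc m)"
    then obtain i where i: "i \<in> alive (Suc m)" "x \<in> mesh_cube n (Suc m) i"
      by (auto simp: percolation_level_def)
    let ?c = "(m, \<chi> j. i $ j div n)"
    have "(Suc m, i) \<in> subtree n ?c"
      using subtree_child[of "(Suc m, i)" n ?c] subtree_self[of "(Suc m, i)" n]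
      by (auto simp: children_def)
    from mesh_cube_subtree[OF this] i show "x \<in> percolation_level n keep \<omega> m"
      by (auto simp: percolation_level_def)
  qed
qed

text \<open>
  The part of each \<open>percolation_level\<close> inside the cube is compact, and non-empty because it contains a
  descendant of the cube. Neighbouring cubes may contribute boundary points to this part, but
  these points belong to the percolation set just as well.
\<close>

lemma survives_imp_percolation_set_meets:
  assumes "survives n kept (m, i)" "i \<in> alive m"
  shows "percolation_set n keep \<omega> \<inter> mesh_cube n m i \<noteq> {}"
proof -
  let ?K = "\<lambda>L. percolation_level n keep \<omega> L \<inter> mesh_cube n m i"
  have "\<Inter>(range ?K) \<noteq> {}"
  proof (rule compact_nest)
    fix L
    show "compact (?K L)"
      unfolding percolation_level_def mesh_cube_def
      by (intro compact_Int compact_UN finite_surviving compact_cbox)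
    have "reaches n kept (\<lambda>_. True) L (m, i)"
      using assms(1) by (simp add: survives_def)
    then obtain c' where c': "fst c' = m + L" "c' \<in> subtree n (m, i)" "snd c' \<in> alive (m + L)"
      using reaches_surviving assms(2) by (metis fst_conv snd_conv)
    have "mesh_cube n (m + L) (snd c') \<subseteq> percolation_level n keep \<omega> (m + L)"
      using c' by (auto simp: percolation_level_def)
    also have "\<dots> \<subseteq> percolation_level n keep \<omega> L"
      by (rule percolation_level_antimono) simp
    finally show "?K L \<noteq> {}"
      using mesh_cube_subtree[OF c'(2)] mesh_cube_nonempty[of "m + L" "snd c'"] c'(1) by auto
  next
    fix L L' :: nat assume "L \<le> L'"
    then show "?K L' \<subseteq> ?K L" using percolation_level_antimono by blast
  qed
  then show ?thesis by (auto simp: percolation_set_def)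
qed

lemma percolation_set_nonempty_iff:
  "percolation_set n keep \<omega> \<noteq> {} \<longleftrightarrow> survives n kept unit_cube_index"
proof
  assume "percolation_set n keep \<omega> \<noteq> {}"
  then have "\<exists>i. i \<in> alive L" for L
    by (auto simp: percolation_set_def percolation_level_def)
  then have "reaches n kept (\<lambda>_. True) L unit_cube_index" for L
    using surviving_reaches[of _ 0 L] by auto
  then show "survives n kept unit_cube_index" by (simp add: survives_def)
next
  assume "survives n kept unit_cube_index"
  then show "percolation_set n keep \<omega> \<noteq> {}"
    using survives_imp_percolation_set_meets[of 0 "\<chi> j. 0"] by auto
qed

lemma full_descendant:
  assumes "full n kept P N c" "snd c \<in> alive (fst c)"
    "fst c' = fst c + N" "\<And>j. snd c' $ j div n ^ N = snd c $ j"
  shows "snd c' \<in> alive (fst c') \<and> P c'"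
  using assms
proof (induction N arbitrary: c)
  case 0
  then have "c' = c" by (simp add: prod_eq_iff vec_eq_iff)
  then show ?case using 0 by simp
next
  case (Suc N)
  let ?c = "(Suc (fst c), \<chi> j. snd c' $ j div n ^ N)"
  have c: "?c \<in> children n c"
    using Suc.prems(4) by (simp add: children_def power_Suc2 div_mult2_eq del: power_Suc)
  then have "keep ?c \<omega>" "full n kept P N ?c" using Suc.prems(1) by auto
  then show ?case
    using Suc.prems(2,3) surviving_child[OF c] by (intro Suc.IH[of ?c]) auto
qed

text \<open>
  All mesh cubes \<open>N\<close> levels below \<open>(m, i)\<close> contain a point of the percolation set, and one of them
  contains \<open>y\<close>.
\<close>

lemma full_cube_dense:
  assumes full: "full n kept (survives n kept) N (m, i)" and i: "i \<in> alive m"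
    and y: "y \<in> mesh_cube n m i"
  shows "\<exists>f\<in>percolation_set n keep \<omega>. dist f y \<le> real CARD('d) / real n ^ (m + N)"
proof -
  have npos: "real n ^ m > 0" for m using n by simp
  have y_bounds: "real (i $ j) \<le> y $ j * real n ^ m" "y $ j * real n ^ m \<le> real (i $ j) + 1" for j
    using y npos[of m] by (auto simp: mesh_cube_def mem_box_cart pos_divide_le_eq pos_le_divide_eq)
  \<comment> \<open>The index of a mesh cube of level \<open>m + N\<close> inside \<open>(m, i)\<close> that contains \<open>y\<close>; the minimum
    handles the points of the upper faces.\<close>
  define l where "l j = min (nat \<lfloor>y $ j * real n ^ (m + N)\<rfloor>) ((i $ j + 1) * n ^ N - 1)" for j
  have l: "real (l j) \<le> y $ j * real n ^ (m + N) \<and> y $ j * real n ^ (m + N) \<le> real (l j) + 1 \<and>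
      l j div n ^ N = i $ j" for j
  proof -
    let ?z = "y $ j * real n ^ (m + N)"
    have z: "real (i $ j * n ^ N) \<le> ?z" "?z \<le> real ((i $ j + 1) * n ^ N)"
      using y_bounds[of j, THEN mult_right_mono, of "real n ^ N"]
      by (simp_all add: power_add mult.assoc distrib_right)
    have "n ^ N \<ge> 1" "(i $ j + 1) * n ^ N = i $ j * n ^ N + n ^ N" using n by simp_all
    then have pos: "(i $ j + 1) * n ^ N \<ge> 1" "i $ j * n ^ N \<le> (i $ j + 1) * n ^ N - 1"
      by linarith+
    have low: "i $ j * n ^ N \<le> nat \<lfloor>?z\<rfloor>" using z(1) by (simp add: le_nat_floor)
    have "?z \<ge> 0" using z(1) by (meson of_nat_0_le_iff order_trans)
    then have fl: "real (nat \<lfloor>?z\<rfloor>) \<le> ?z" "?z \<le> real (nat \<lfloor>?z\<rfloor>) + 1" by linarith+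
    have "real ((i $ j + 1) * n ^ N - 1) + 1 = real ((i $ j + 1) * n ^ N)"
      using pos(1) by linarith
    then have "real (l j) \<le> ?z" "?z \<le> real (l j) + 1"
      using fl z(2) unfolding l_def by (auto simp: min_def)
    moreover have "i $ j * n ^ N \<le> l j" "l j < (i $ j + 1) * n ^ N"
      using low pos unfolding l_def by linarith+
    then have "l j div n ^ N = i $ j"
      by (intro div_nat_eqI) (simp_all add: mult.commute)
    ultimately show ?thesis by simp
  qed
  define i' where "i' = (\<chi> j. l j)"
  have "i' \<in> alive (m + N) \<and> survives n kept (m + N, i')"
    using full_descendant[OF full, of "(m + N, i')"] i l by (simp add: i'_def)
  then obtain f where f: "f \<in> percolation_set n keep \<omega>" "f \<in> mesh_cube n (m + N) i'"
    using survives_imp_percolation_set_meets[of "m + N" i'] by blast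
  have "\<bar>(f - y) $ j\<bar> \<le> 1 / real n ^ (m + N)" for j
  proof -
    have "real (l j) / real n ^ (m + N) \<le> f $ j" "f $ j \<le> (real (l j) + 1) / real n ^ (m + N)"
      using f(2) by (auto simp: mesh_cube_def mem_box_cart i'_def)
    moreover have "real (l j) / real n ^ (m + N) \<le> y $ j" "y $ j \<le> (real (l j) + 1) / real n ^ (m + N)"
      using l[of j] npos[of "m + N"] by (simp_all add: pos_divide_le_eq pos_le_divide_eq)
    ultimately show ?thesis
      by (simp add: add_divide_distrib abs_le_iff)
  qed
  then have "norm (f - y) \<le> (\<Sum>j\<in>(UNIV::'d set). 1 / real n ^ (m + N))"
    by (intro order.trans[OF norm_le_l1_cart] sum_mono) auto
  then show ?thesis using f(1) by (auto simp: dist_norm)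
qed

end

section \<open>Probabilities of events in the tree\<close>

context fractal_percolation
begin

text \<open>
  The \<open>\<sigma>\<close>-algebra of the events that depend only on the decisions for the cubes in \<open>K\<close>.
\<close>

definition decisions :: "(nat \<times> (nat ^ 'd)) set \<Rightarrow> 'w measure" where
  "decisions K = sigma (space M) (\<Union>c\<in>K. {keep c -` A \<inter> space M | A. A \<in> UNIV})"

lemma space_decisions [simp]: "space (decisions K) = space M"
  by (auto simp: decisions_def intro!: space_measure_of)

lemma sets_decisions:
  "sets (decisions K) = sigma_sets (space M) (\<Union>c\<in>K. {keep c -` A \<inter> space M | A. A \<in> UNIV})"
  unfolding decisions_def by (intro sets_measure_of) auto

lemma sets_decisions_mono: "K \<subseteq> K' \<Longrightarrow> sets (decisions K) \<subseteq> sets (decisions K')"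
  unfolding sets_decisions by (intro sigma_sets_mono') blast

lemma indep_keep_sets: "indep_sets (\<lambda>c. {keep c -` A \<inter> space M | A. A \<in> UNIV}) (mesh_indices n)"
  using indep_keep unfolding indep_vars_def2 by simp

lemma sets_decisions_events:
  assumes "K \<subseteq> mesh_indices n"
  shows "sets (decisions K) \<subseteq> events"
  unfolding sets_decisions
proof (rule sets.sigma_sets_subset)
  show "(\<Union>c\<in>K. {keep c -` A \<inter> space M |A. A \<in> UNIV}) \<subseteq> events"
    using indep_keep_sets assms unfolding indep_sets_def by blast
qed

lemma keep_in_decisions:
  assumes "c \<in> K"
  shows "{\<omega> \<in> space M. keep c \<omega>} \<in> sets (decisions K)"
proof -
  have "{\<omega> \<in> space M. keep c \<omega>} = keep c -` {True} \<inter> space M" by auto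
  then show ?thesis
    unfolding sets_decisions using assms by (intro sigma_sets.Basic) blast
qed

lemma indep_decisions:
  assumes "disjoint_family_on K J" "\<And>j. j \<in> J \<Longrightarrow> K j \<subseteq> mesh_indices n"
  shows "indep_sets (\<lambda>j. sets (decisions (K j))) J"
  unfolding sets_decisions
proof (rule indep_sets_collect_sigma)
  show "indep_sets (\<lambda>c. {keep c -` A \<inter> space M | A. A \<in> UNIV}) (\<Union>j\<in>J. K j)"
    using assms(2) by (intro indep_sets_mono_index[OF _ indep_keep_sets]) auto
  show "Int_stable {keep c -` A \<inter> space M | A. A \<in> UNIV}" for c
  proof (rule Int_stableI)
    fix a b assume "a \<in> {keep c -` A \<inter> space M | A. A \<in> UNIV}" "b \<in> {keep c -` A \<inter> space M | A. A \<in> UNIV}"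
    then obtain A B where "a = keep c -` A \<inter> space M" "b = keep c -` B \<inter> space M" by blast
    then have "a \<inter> b = keep c -` (A \<inter> B) \<inter> space M" by blast
    then show "a \<inter> b \<in> {keep c -` A \<inter> space M | A. A \<in> UNIV}" by blast
  qed
qed (fact assms(1))

lemma prob_keep_Int:
  assumes c: "in_unit_cube n c" "c \<in> mesh_indices n" and "n > 0"
    and E: "E \<in> sets (decisions (subtree n c - {c}))"
  shows "prob ({\<omega> \<in> space M. keep c \<omega>} \<inter> E) = p * prob E"
proof -
  let ?K = "\<lambda>b. if b then {c} else subtree n c - {c}"
  let ?A = "\<lambda>b. if b then {\<omega> \<in> space M. keep c \<omega>} else E"
  have "indep_sets (\<lambda>b. sets (decisions (?K b))) UNIV"
    using c subtree_subset_mesh_indices[OF c(1) \<open>n > 0\<close>]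
    by (intro indep_decisions) (auto simp: disjoint_family_on_def)
  then have "prob (\<Inter>b\<in>UNIV. ?A b) = (\<Prod>b\<in>UNIV. prob (?A b))"
    by (rule indep_setsD) (use E keep_in_decisions[of c "{c}"] in auto)
  then show ?thesis
    using prob_keep[OF c(2)] by (simp add: UNIV_bool Int_commute mult.commute)
qed

text \<open>
  What happens to a child and inside it depends on the decisions in its subtree, and the subtrees of
  the children are disjoint. For the union, pass to complements.
\<close>

lemma children_independent:
  fixes E :: "nat \<times> (nat ^ 'd) \<Rightarrow> 'w set"
  assumes c: "in_unit_cube n c" and n: "n > 0"
    and E: "\<And>c'. c' \<in> children n c \<Longrightarrow> E c' \<in> sets (decisions (subtree n c' - {c'}))"
    and q: "\<And>c'. c' \<in> children n c \<Longrightarrow> prob (E c') = q"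
  shows "prob (\<Inter>c'\<in>children n c. {\<omega> \<in> space M. keep c' \<omega>} \<inter> E c') = (p * q) ^ (n ^ CARD('d))"
    and "prob (\<Union>c'\<in>children n c. {\<omega> \<in> space M. keep c' \<omega>} \<inter> E c') = survival_fun (n ^ CARD('d)) p q"
proof -
  let ?C = "children n c"
  let ?H = "\<lambda>c'. {\<omega> \<in> space M. keep c' \<omega>} \<inter> E c'"
  have C: "finite ?C" "?C \<noteq> {}" "card ?C = n ^ CARD('d)"
    using children_finite_card[OF n, of c] children_nonempty[OF n, of c] by auto
  have mesh: "subtree n c' \<subseteq> mesh_indices n" if "c' \<in> ?C" for c'
    using subtree_child[OF that] subtree_subset_mesh_indices[OF c n] by blast
  have H: "?H c' \<in> sets (decisions (subtree n c'))" if "c' \<in> ?C" for c'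
    using E[OF that] keep_in_decisions[OF subtree_self, of c'] sets_decisions_mono[of "subtree n c' - {c'}" "subtree n c'"]
    by (intro sets.Int) auto
  have prob_H: "prob (?H c') = p * q" if "c' \<in> ?C" for c'
    using prob_keep_Int[OF in_unit_cube_child[OF c that n] _ n E[OF that]] q[OF that]
      mesh[OF that] subtree_self[of c' n] by auto
  have H_event: "?H c' \<in> events" if "c' \<in> ?C" for c'
    using H[OF that] sets_decisions_events[OF mesh[OF that]] by blast
  have indep: "indep_sets (\<lambda>c'. sets (decisions (subtree n c'))) ?C"
    by (intro indep_decisions disjoint_subtrees mesh)
  have "prob (\<Inter>c'\<in>?C. ?H c') = (\<Prod>c'\<in>?C. prob (?H c'))"
    using indep C H by (intro indep_setsD[OF indep]) auto
  also have "\<dots> = (\<Prod>c'\<in>?C. p * q)" by (intro prod.cong prob_H refl)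
  finally show "prob (\<Inter>c'\<in>?C. ?H c') = (p * q) ^ (n ^ CARD('d))"
    by (simp add: C)
  have compl: "space M - ?H c' \<in> sets (decisions (subtree n c'))" if "c' \<in> ?C" for c'
    using sets.compl_sets[OF H[OF that]] by simp
  have "prob (\<Inter>c'\<in>?C. space M - ?H c') = (\<Prod>c'\<in>?C. prob (space M - ?H c'))"
    using indep C compl by (intro indep_setsD[OF indep]) auto
  also have "\<dots> = (\<Prod>c'\<in>?C. 1 - p * q)"
    by (intro prod.cong refl) (simp add: prob_compl[OF H_event] prob_H)
  also have "(\<Inter>c'\<in>?C. space M - ?H c') = space M - (\<Union>c'\<in>?C. ?H c')"
    using C(2) by blast
  also have "prob (space M - (\<Union>c'\<in>?C. ?H c')) = 1 - prob (\<Union>c'\<in>?C. ?H c')"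
    using C(1) H_event by (intro prob_compl sets.finite_UN) auto
  finally show "prob (\<Union>c'\<in>?C. ?H c') = survival_fun (n ^ CARD('d)) p q"
    by (simp add: survival_fun_def C)
qed

text \<open>
  Statistical self-similarity: a property that depends only on the decisions strictly below a cube,
  and whose probability is the same for every cube.
\<close>

definition homogeneous :: "('w \<Rightarrow> nat \<times> (nat ^ 'd) \<Rightarrow> bool) \<Rightarrow> real \<Rightarrow> bool" where
  "homogeneous P q \<longleftrightarrow>
     (\<forall>c. {\<omega> \<in> space M. P \<omega> c} \<in> sets (decisions (subtree n c - {c}))) \<and>
     (\<forall>c. in_unit_cube n c \<longrightarrow> prob {\<omega> \<in> space M. P \<omega> c} = q)"

lemma homogeneous_sets:
  "homogeneous P q \<Longrightarrow> {\<omega> \<in> space M. P \<omega> c} \<in> sets (decisions (subtree n c - {c}))"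
  unfolding homogeneous_def by blast

lemma homogeneous_prob:
  "homogeneous P q \<Longrightarrow> in_unit_cube n c \<Longrightarrow> prob {\<omega> \<in> space M. P \<omega> c} = q"
  unfolding homogeneous_def by blast

abbreviation (input) kept_at :: "'w \<Rightarrow> nat \<times> (nat ^ 'd) \<Rightarrow> bool" where
  "kept_at \<omega> \<equiv> \<lambda>c. keep c \<omega>"

lemma kept_Int_in_decisions:
  assumes "c' \<in> children n c" "A \<in> sets (decisions (subtree n c' - {c'}))"
  shows "{\<omega> \<in> space M. keep c' \<omega>} \<inter> A \<in> sets (decisions (subtree n c - {c}))"
proof (rule sets.Int)
  show "{\<omega> \<in> space M. keep c' \<omega>} \<in> sets (decisions (subtree n c - {c}))"
    using subtree_child[OF assms(1)] subtree_self[of c' n] by (intro keep_in_decisions) auto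
  show "A \<in> sets (decisions (subtree n c - {c}))"
    using sets_decisions_mono[of "subtree n c' - {c'}" "subtree n c - {c}"]
      subtree_child[OF assms(1)] assms(2) by blast
qed

lemma homogeneous_True: "homogeneous (\<lambda>\<omega> c. True) 1"
  using sets.top[of "decisions _"] by (auto simp: homogeneous_def prob_space)

lemma homogeneous_children:
  assumes P: "homogeneous P q" and n: "n > 0"
  shows "homogeneous (\<lambda>\<omega> c. \<exists>c'\<in>children n c. keep c' \<omega> \<and> P \<omega> c') (survival_fun (n ^ CARD('d)) p q)"
    and "homogeneous (\<lambda>\<omega> c. \<forall>c'\<in>children n c. keep c' \<omega> \<and> P \<omega> c') ((p * q) ^ (n ^ CARD('d)))"
proof -
  let ?H = "\<lambda>c'. {\<omega> \<in> space M. keep c' \<omega>} \<inter> {\<omega> \<in> space M. P \<omega> c'}"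
  note P' = homogeneous_sets[OF P] homogeneous_prob[OF P]
  have un: "{\<omega> \<in> space M. \<exists>c'\<in>children n c. keep c' \<omega> \<and> P \<omega> c'} = (\<Union>c'\<in>children n c. ?H c')" for c
    by auto
  have inter: "{\<omega> \<in> space M. \<forall>c'\<in>children n c. keep c' \<omega> \<and> P \<omega> c'} = (\<Inter>c'\<in>children n c. ?H c')" for c
    using children_nonempty[OF n, of c] by auto
  have H: "?H c' \<in> sets (decisions (subtree n c - {c}))" if "c' \<in> children n c" for c c'
    using P'(1) that by (intro kept_Int_in_decisions) auto
  note C = children_finite_card(1)[OF n] children_nonempty[OF n]
  have "(\<Union>c'\<in>children n c. ?H c') \<in> sets (decisions (subtree n c - {c}))" for c
    by (intro sets.finite_UN C H)
  moreover have "prob (\<Union>c'\<in>children n c. ?H c') = survival_fun (n ^ CARD('d)) p q"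
    if "in_unit_cube n c" for c
    using that n P'(1) P'(2)[OF in_unit_cube_child[OF that _ n]] by (rule children_independent(2))
  ultimately show "homogeneous (\<lambda>\<omega> c. \<exists>c'\<in>children n c. keep c' \<omega> \<and> P \<omega> c') (survival_fun (n ^ CARD('d)) p q)"
    unfolding homogeneous_def un by blast
  have "(\<Inter>c'\<in>children n c. ?H c') \<in> sets (decisions (subtree n c - {c}))" for c
    by (intro sets.finite_INT C H)
  moreover have "prob (\<Inter>c'\<in>children n c. ?H c') = (p * q) ^ (n ^ CARD('d))"
    if "in_unit_cube n c" for c
    using that n P'(1) P'(2)[OF in_unit_cube_child[OF that _ n]] by (rule children_independent(1))
  ultimately show "homogeneous (\<lambda>\<omega> c. \<forall>c'\<in>children n c. keep c' \<omega> \<and> P \<omega> c') ((p * q) ^ (n ^ CARD('d)))"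
    unfolding homogeneous_def inter by blast
qed

lemma homogeneous_reaches:
  assumes "homogeneous P q" "n > 0"
  shows "homogeneous (\<lambda>\<omega>. reaches n (kept_at \<omega>) (P \<omega>) L) ((survival_fun (n ^ CARD('d)) p ^^ L) q)"
  by (induction L) (use assms homogeneous_children(1) in auto)

lemma homogeneous_full:
  assumes "homogeneous P q" "n > 0" "q > 0" "p > 0"
  shows "\<exists>q'>0. homogeneous (\<lambda>\<omega>. full n (kept_at \<omega>) (P \<omega>) N) q'"
proof (induction N)
  case (Suc N)
  then obtain q' where "q' > 0" "homogeneous (\<lambda>\<omega>. full n (kept_at \<omega>) (P \<omega>) N) q'" by blast
  then show ?case
    using homogeneous_children(2)[of _ q'] assms
    by (intro exI[of _ "(p * q') ^ (n ^ CARD('d))"]) auto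
qed (use assms in auto)

lemma survives_in_decisions:
  assumes "n > 0"
  shows "{\<omega> \<in> space M. survives n (kept_at \<omega>) c} \<in> sets (decisions (subtree n c - {c}))"
proof -
  have "{\<omega> \<in> space M. survives n (kept_at \<omega>) c} =
      (\<Inter>L. {\<omega> \<in> space M. reaches n (kept_at \<omega>) (\<lambda>_. True) L c})"
    by (auto simp: survives_def)
  also have "\<dots> \<in> sets (decisions (subtree n c - {c}))"
    using homogeneous_sets[OF homogeneous_reaches[OF homogeneous_True assms]]
    by (intro sets.countable_INT image_subsetI) simp_all
  finally show ?thesis .
qed

text \<open>
  The probability that \<open>L\<close> further generations exist is the \<open>L\<close>-th iterate of the survival function at
  \<open>1\<close>; let \<open>L\<close> tend to infinity.
\<close>

lemma homogeneous_survives: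
  assumes "(\<lambda>L. (survival_fun (n ^ CARD('d)) p ^^ L) 1) \<longlonglongrightarrow> h" "n > 0"
  shows "homogeneous (\<lambda>\<omega>. survives n (kept_at \<omega>)) h"
proof -
  let ?R = "\<lambda>c L. {\<omega> \<in> space M. reaches n (kept_at \<omega>) (\<lambda>_. True) L c}"
  have R: "homogeneous (\<lambda>\<omega>. reaches n (kept_at \<omega>) (\<lambda>_. True) L) ((survival_fun (n ^ CARD('d)) p ^^ L) 1)" for L
    using homogeneous_reaches[OF homogeneous_True assms(2)] .
  have eq: "{\<omega> \<in> space M. survives n (kept_at \<omega>) c} = (\<Inter>L. ?R c L)" for c
    by (auto simp: survives_def)
  have "prob (\<Inter>L. ?R c L) = h" if c: "in_unit_cube n c" for c
  proof -
    have "range (?R c) \<subseteq> events"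
      using homogeneous_sets[OF R] sets_decisions_events[OF subtree_subset_mesh_indices[OF c assms(2)]]
      by blast
    moreover have "decseq (?R c)"
      by (auto simp: decseq_def intro: reaches_antimono)
    ultimately have "(\<lambda>L. prob (?R c L)) \<longlonglongrightarrow> prob (\<Inter>L. ?R c L)"
      by (rule finite_Lim_measure_decseq)
    moreover have "prob (?R c L) = (survival_fun (n ^ CARD('d)) p ^^ L) 1" for L
      using homogeneous_prob[OF R c] .
    ultimately show ?thesis using LIMSEQ_unique[OF _ assms(1)] by simp
  qed
  then show ?thesis
    unfolding homogeneous_def using survives_in_decisions[OF assms(2)] by (simp add: eq)
qed

text \<open>
  Let \<open>h\<close> be the survival probability and \<open>q\<close> the probability that a cube is full to depth \<open>N\<close>. Then
  \<open>0 < q \<le> h\<close>, and a cube has a kept descendant at level \<open>L\<close> below it that is full to depth \<open>N\<close> with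
  probability \<open>g\<^sup>L q\<close>, where \<open>g\<close> is the survival function. This event implies survival, and its probability
  tends to \<open>h\<close>. So the event of survival exceeds the union of these events only by a null set.
\<close>

lemma AE_survives_imp_reaches_full:
  assumes p: "0 < p" "p < 1" and n: "n > 0" and super: "1 < p * real (n ^ CARD('d))"
    and c: "in_unit_cube n c"
  shows "AE \<omega> in M. survives n (kept_at \<omega>) c \<longrightarrow>
      (\<exists>L\<ge>L0. reaches n (kept_at \<omega>) (full n (kept_at \<omega>) (survives n (kept_at \<omega>)) N) L c)"
proof -
  let ?g = "survival_fun (n ^ CARD('d)) p"
  obtain h where h: "0 < h" "(\<lambda>L. (?g ^^ L) 1) \<longlonglongrightarrow> h"
      "\<And>u. \<lbrakk>0 < u; u \<le> h\<rbrakk> \<Longrightarrow> (\<lambda>L. (?g ^^ L) u) \<longlonglongrightarrow> h"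
    using survival_fun_iterates_converge[OF p super] by metis
  have S: "homogeneous (\<lambda>\<omega>. survives n (kept_at \<omega>)) h"
    using homogeneous_survives[OF h(2) n] .
  let ?F = "\<lambda>\<omega>. full n (kept_at \<omega>) (survives n (kept_at \<omega>)) N"
  obtain q where q: "q > 0" "homogeneous ?F q"
    using homogeneous_full[OF S n h(1) p(1)] by blast
  have in_events: "{\<omega> \<in> space M. P \<omega> c} \<in> events" if "homogeneous P u" for P u
    using homogeneous_sets[OF that] sets_decisions_events[OF subtree_subset_mesh_indices[OF c n]]
    by blast
  note prob_eq = homogeneous_prob[OF _ c]
  let ?S = "{\<omega> \<in> space M. survives n (kept_at \<omega>) c}"
  let ?E = "\<lambda>L. {\<omega> \<in> space M. reaches n (kept_at \<omega>) (?F \<omega>) L c}"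
  have S_event: "?S \<in> events" using in_events[OF S] .
  have E: "homogeneous (\<lambda>\<omega>. reaches n (kept_at \<omega>) (?F \<omega>) L) ((?g ^^ L) q)" for L
    using homogeneous_reaches[OF q(2) n] .
  have E_event: "?E L \<in> events" for L using in_events[OF E] .
  have "{\<omega> \<in> space M. ?F \<omega> c} \<subseteq> ?S"
    using full_imp_survives[OF _ n] by blast
  then have "prob {\<omega> \<in> space M. ?F \<omega> c} \<le> prob ?S"
    using S_event by (rule finite_measure_mono)
  then have "q \<le> h"
    unfolding prob_eq[OF S] prob_eq[OF q(2)] .
  then have lim: "(\<lambda>L. (?g ^^ L) q) \<longlonglongrightarrow> h" using h(3) q(1) by blast
  have E_sub: "?E L \<subseteq> ?S" for L
  proof safe
    fix \<omega> assume "reaches n (kept_at \<omega>) (?F \<omega>) L c"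
    then have "reaches n (kept_at \<omega>) (survives n (kept_at \<omega>)) L c"
      by (rule reaches_mono) (rule full_imp_survives[OF _ n])
    then show "survives n (kept_at \<omega>) c" by (rule reaches_survives_imp_survives)
  qed
  let ?U = "\<Union>L\<in>{L0..}. ?E L"
  have U: "?U \<in> events" using E_event by blast
  have "prob (?S - ?U) \<le> h - (?g ^^ L) q" if "L \<ge> L0" for L
  proof -
    have "prob (?S - ?U) \<le> prob (?S - ?E L)"
      using that S_event E_event by (intro finite_measure_mono) auto
    also have "\<dots> = prob ?S - prob (?E L)"
      using S_event E_event E_sub by (rule finite_measure_Diff)
    finally show ?thesis using prob_eq[OF S] prob_eq[OF E] by simp
  qed
  moreover have "(\<lambda>L. h - (?g ^^ L) q) \<longlonglongrightarrow> h - h"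
    using lim by (intro tendsto_intros)
  ultimately have "prob (?S - ?U) \<le> 0"
    using LIMSEQ_le_const[of _ "h - h" "prob (?S - ?U)"] by auto
  then have "prob (?S - ?U) = 0" using measure_nonneg[of M "?S - ?U"] by linarith
  then have "AE \<omega> in M. \<omega> \<notin> ?S - ?U"
    using S_event U by (intro AE_not_in) (auto simp: null_sets_def emeasure_eq_measure)
  then show "AE \<omega> in M. survives n (kept_at \<omega>) c \<longrightarrow> (\<exists>L\<ge>L0. reaches n (kept_at \<omega>) (?F \<omega>) L c)"
    by (rule AE_mp) (auto intro!: AE_I2)
qed

end

section \<open>The dimension of fractal percolation and of its projections\<close>

text \<open>
  The balls are those inscribed in the full cubes. The depth \<open>N\<close> controls the density relative to the
  radius, and the level of the cube controls the radius.
\<close>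

lemma full_cubes_imp_locally_almost_dense:
  fixes keep :: "nat \<times> (nat ^ 'd::finite) \<Rightarrow> 'w \<Rightarrow> bool"
  assumes n: "n \<ge> 2"
    and full: "\<And>N m0. \<exists>m i. m \<ge> m0 \<and> i \<in> surviving n keep \<omega> m \<and>
      full n (\<lambda>c. keep c \<omega>) (survives n (\<lambda>c. keep c \<omega>)) N (m, i)"
  shows "locally_almost_dense (percolation_set n keep \<omega>)"
  unfolding locally_almost_dense_def
proof (intro allI impI)
  fix \<eta> \<delta> :: real assume "\<eta> > 0" "\<delta> > 0"
  have small: "\<exists>m. 1 / real n ^ m < e" if "e > 0" for e
    using real_arch_pow_inv[OF that, of "1 / real n"] n by (auto simp: power_one_over)
  obtain N where N: "1 / real n ^ N < \<eta> / (2 * real CARD('d))"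
    using small[of "\<eta> / (2 * real CARD('d))"] \<open>\<eta> > 0\<close> by auto
  obtain m0 where m0: "1 / real n ^ m0 < \<delta>"
    using small[OF \<open>\<delta> > 0\<close>] by auto
  obtain m i where mi: "m \<ge> m0" "i \<in> surviving n keep \<omega> m"
      "full n (\<lambda>c. keep c \<omega>) (survives n (\<lambda>c. keep c \<omega>)) N (m, i)"
    using full by blast
  define s where "s = (1 / real n ^ m) / 2"
  define z :: "real ^ 'd" where "z = (\<chi> j. (real (i $ j) + 1/2) / real n ^ m)"
  have s: "s > 0" using n by (simp add: s_def)
  have "1 / real n ^ m \<le> 1 / real n ^ m0"
    using n mi(1) by (intro divide_left_mono power_increasing) auto
  then have "s < \<delta>" using m0 s unfolding s_def by linarith
  moreover have "\<exists>f\<in>percolation_set n keep \<omega>. dist f y \<le> \<eta> * s" if y: "y \<in> cball z s" for y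
  proof -
    have "\<bar>z $ j - y $ j\<bar> \<le> s" for j
      using y component_le_norm_cart[of "z - y" j] by (simp add: dist_norm)
    then have "z $ j - s \<le> y $ j \<and> y $ j \<le> z $ j + s" for j
      by (simp add: abs_le_iff algebra_simps)
    moreover have "z $ j - s = real (i $ j) / real n ^ m" "z $ j + s = (real (i $ j) + 1) / real n ^ m" for j
      by (simp_all add: z_def s_def add_divide_distrib)
    ultimately have "y \<in> mesh_cube n m i"
      by (simp add: mesh_cube_def mem_box_cart)
    from full_cube_dense[OF n mi(3,2) this] obtain f where f:
      "f \<in> percolation_set n keep \<omega>" "dist f y \<le> real CARD('d) / real n ^ (m + N)" by blast
    have "real CARD('d) / real n ^ (m + N) = real CARD('d) * (1 / real n ^ N) * (2 * s)"
      by (simp add: s_def power_add)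
    also have "\<dots> \<le> real CARD('d) * (\<eta> / (2 * real CARD('d))) * (2 * s)"
      using N s by (intro mult_right_mono mult_left_mono) auto
    also have "\<dots> = \<eta> * s" by simp
    finally show ?thesis using f by (intro bexI[of _ f]) linarith+
  qed
  ultimately show "\<exists>z s. 0 < s \<and> s < \<delta> \<and> (\<forall>y\<in>cball z s. \<exists>f\<in>percolation_set n keep \<omega>. dist f y \<le> \<eta> * s)"
    using s by blast
qed

theorem theorem5p1:
  fixes M :: "'w measure" and n :: nat and p :: real
    and keep :: "nat \<times> (nat ^ 'd::finite) \<Rightarrow> 'w \<Rightarrow> bool"
    and F :: "'w \<Rightarrow> (real ^ 'd) set"
  defines "F \<equiv> percolation_set n keep"
  assumes "n \<ge> 2" and "0 < p" and "p < 1" and "p > 1 / real n ^ CARD('d)"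
    and "fractal_percolation M n p keep"
  shows "AE \<omega> in uniform_measure M {\<omega> \<in> space M. F \<omega> \<noteq> {}}.
      assouad_dim (F \<omega>) = real CARD('d) \<and>
      (\<forall>k \<le> CARD('d). \<forall>\<pi> \<in> orth_projections k. assouad_dim (\<pi> ` F \<omega>) = real k)"
proof -
  interpret fractal_percolation M n p keep by fact
  let ?c = "(0::nat, (\<chi> j. 0) :: nat ^ 'd)"
  have n: "n > 0" using \<open>n \<ge> 2\<close> by simp
  have super: "1 < p * real (n ^ CARD('d))"
    using \<open>p > 1 / real n ^ CARD('d)\<close> n by (simp add: pos_divide_less_eq)
  have c: "in_unit_cube n ?c" by (simp add: in_unit_cube_def)
  have nonempty: "F \<omega> \<noteq> {} \<longleftrightarrow> survives n (kept_at \<omega>) ?c" for \<omega>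
    unfolding F_def by (rule percolation_set_nonempty_iff[OF \<open>n \<ge> 2\<close>])
  \<comment> \<open>The identity is the projection onto the whole space, so the claim on \<open>F\<close> itself is a special case.\<close>
  have id: "id \<in> (orth_projections CARD('d) :: (real ^ 'd \<Rightarrow> real ^ 'd) set)"
    by (auto simp: orth_projections_def orthogonal_def intro!: exI[of _ UNIV])
  have conclusion: "assouad_dim (F \<omega>) = real CARD('d) \<and>
      (\<forall>k \<le> CARD('d). \<forall>\<pi> \<in> orth_projections k. assouad_dim (\<pi> ` F \<omega>) = real k)"
    if full: "\<And>N m0. \<exists>L\<ge>m0. reaches n (kept_at \<omega>) (full n (kept_at \<omega>) (survives n (kept_at \<omega>)) N) L ?c" for \<omega>
  proof -
    have "locally_almost_dense (F \<omega>)"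
      unfolding F_def
    proof (rule full_cubes_imp_locally_almost_dense[OF \<open>n \<ge> 2\<close>])
      fix N m0
      obtain L where L: "L \<ge> m0"
          "reaches n (kept_at \<omega>) (full n (kept_at \<omega>) (survives n (kept_at \<omega>)) N) L ?c"
        using full by blast
      have "snd ?c \<in> surviving n keep \<omega> (fst ?c)" by simp
      then obtain c' where c': "fst c' = fst ?c + L" "snd c' \<in> surviving n keep \<omega> (fst c')"
          "full n (kept_at \<omega>) (survives n (kept_at \<omega>)) N c'"
        using reaches_surviving[OF \<open>n \<ge> 2\<close>, where keep = keep and \<omega> = \<omega>, OF L(2)] by blast
      obtain m i where "c' = (m, i)" by (cases c')
      with c' have "m = L" "i \<in> surviving n keep \<omega> m"
          "full n (kept_at \<omega>) (survives n (kept_at \<omega>)) N (m, i)"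
        by simp_all
      then show "\<exists>m i. m0 \<le> m \<and> i \<in> surviving n keep \<omega> m \<and> full n (kept_at \<omega>) (survives n (kept_at \<omega>)) N (m, i)"
        using L(1) by blast
    qed
    then have dim: "assouad_dim (\<pi> ` F \<omega>) = real k" if "\<pi> \<in> orth_projections k" for \<pi> k
      using assouad_dim_projection that by blast
    then show ?thesis using dim[OF id] by simp
  qed
  show ?thesis
  proof (rule AE_uniform_measureI)
    show "{\<omega> \<in> space M. F \<omega> \<noteq> {}} \<in> events"
      using survives_in_decisions[OF n] sets_decisions_events[OF subtree_subset_mesh_indices[OF c n]]
      unfolding nonempty by blast
    \<comment> \<open>The exceptional set is a countable union over \<open>N\<close> and \<open>m0\<close>; \<open>k\<close> and \<open>\<pi>\<close> do not enter it.\<close>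
    have "AE \<omega> in M. \<forall>N m0. survives n (kept_at \<omega>) ?c \<longrightarrow>
      (\<exists>L\<ge>m0. reaches n (kept_at \<omega>) (full n (kept_at \<omega>) (survives n (kept_at \<omega>)) N) L ?c)"
      unfolding AE_all_countable
      using AE_survives_imp_reaches_full[OF \<open>0 < p\<close> \<open>p < 1\<close> n super c] by blast
    then show "AE \<omega> in M. \<omega> \<in> {\<omega> \<in> space M. F \<omega> \<noteq> {}} \<longrightarrow> assouad_dim (F \<omega>) = real CARD('d) \<and>
      (\<forall>k \<le> CARD('d). \<forall>\<pi> \<in> orth_projections k. assouad_dim (\<pi> ` F \<omega>) = real k)"
    proof eventually_elim
      case (elim \<omega>)
      show ?case
      proof
        assume "\<omega> \<in> {\<omega> \<in> space M. F \<omega> \<noteq> {}}"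
        then have "survives n (kept_at \<omega>) ?c" by (simp add: nonempty)
        with elim show "assouad_dim (F \<omega>) = real CARD('d) \<and>
          (\<forall>k \<le> CARD('d). \<forall>\<pi> \<in> orth_projections k. assouad_dim (\<pi> ` F \<omega>) = real k)"
          by (intro conclusion) blast
      qed
    qed
  qed
qed

end
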